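(* Let $g\geq0$, $b\geq1$, $n\geq1$ ($n\geq3$ if $g=0$) and let $\ell_1,\ldots,\ell_n\geq b$ be integers. Let $\hat{\mathcal{G}}_{g,n}^{(\geq b)}(\ell_1,\ldots,\ell_n)$ be the set of genus-$g$ maps with $n$ labeled faces of degrees $2\ell_1,\ldots,2\ell_n$, no vertices of degree one, and essential girth at least $2b$, and let $\hat{\mathcal{G}}_{g,n}^{(b)}(\ell_1,\ldots,\ell_n)$ be the subset of those with essential girth exactly $2b$. Then $$\|\hat{\mathcal{G}}_{g,n}^{(\geq b)}(\ell_1,\ldots,\ell_n)\|=\hat{N}_{g,n}^{(b-1)}(\ell_1,\ldots,\ell_n),$$ which is polynomial in $b,\ell_1,\ldots,\ell_n$, and $$\|\hat{\mathcal{G}}_{g,n}^{(b)}(\ell_1,\ldots,\ell_n)\|=\hat{N}_{g,n}^{(b-1)}(\ell_1,\ldots,\ell_n)-\mathbf{1}_{\{\ell_1,\ldots,\ell_n>b\}}\hat{N}_{g,n}^{(b)}(\ell_1,\ldots,\ell_n),$$ which is again polynomial when restricted to $\ell_1,\ldots,\ell_n>b$.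
   Context: A genus-$g$ map is a (multi)graph embedded in a closed oriented surface of genus $g$ such that edges meet only at endpoints and the complement of the graph is a disjoint union of topological disks (the faces), viewed up to orientation-preserving homeomorphisms. The degree of a face is the number of edge sides bounding it. For a set $\mathcal{M}$ of maps with labeled faces, $\|\mathcal{M}\|=\sum_{\mathfrak{m}\in\mathcal{M}}\frac{1}{|\mathrm{Aut}(\mathfrak{m})|}$, where $\mathrm{Aut}(\mathfrak{m})$ is the group of orientation-preserving automorphisms preserving the face labels. The girth of a map is the length of its shortest simple cycle. The essential girth of a genus-$g$ map is the girth of its lift to the universal cover of the surface (for $g=0$ it is the girth of the map itself). A (finite or infinite) planar map is $2b$-irreducible if it contains no simple cycle of length smaller than $2b$ and every simple cycle of length $2b$ is the boundary of a face of degree $2b$; every map is $0$-irreducible. A genus-$g$ map with $g\geq1$ is essentially $2b$-irreducible if its lift to the universal cover, viewed as an infinite planar map, is $2b$-irreducible; for $g=0$ this means $2b$-irreducible. For $g,b\geq0$, $n\geq1$ ($n\geq3$ if $g=0$) and $\ell_1,\ldots,\ell_n\geq\max(b,1)$, $\hat{\mathcal{M}}^{(b)}_{g,n}(\ell_1,\ldots,\ell_n)$ is the set of essentially $2b$-irreducible genus-$g$ maps with $n$ labeled faces of degrees $2\ell_1,\ldots,2\ell_n$ and no vertex of degree $1$. It is known that there is a unique symmetric polynomial $\hat N^{(b)}_{g,n}(\ell_1,\ldots,\ell_n)$ in $\ell_1^2,\ldots,\ell_n^2$, depending polynomially on $b$ as well, such that for all integers $\ell_1,\ldots,\ell_n\geq\max(b,1)$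 $$\|\hat{\mathcal{M}}^{(b)}_{g,n}(\ell_1,\ldots,\ell_n)\|=\hat{N}_{g,n}^{(b)}(\ell_1,\ldots,\ell_n)+\mathbf{1}_{\{g=0,\,n\geq4,\,\ell_1=\cdots=\ell_n=b\}}\frac{(n-1)!}{2}(-1)^n.$$ *)

theory Defs
  imports Complex_Main
    "HOL-Library.Extended_Nat"
    "HOL-Library.Poly_Mapping"
    "HOL-Combinatorics.Permutations"
    "HOL-Combinatorics.Orbits"
begin

text \<open>
  Maps are encoded by rotation systems. A dart is an oriented edge; \<open>rot\<close> sends a dart to the
  next one clockwise around its initial vertex and \<open>opp\<close> reverses it. Following a dart and then
  turning clockwise traces the face on its left. Vertices, edges and faces are thus the orbits of
  \<open>rot\<close>, \<open>opp\<close> and \<open>rot \<circ> opp\<close>, and orientation-preserving homeomorphism of maps becomes conjugation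
  of the rotation systems. The same record is used for the (infinite) universal covers.
\<close>

record 'd rot_system =
  darts :: "'d set"
  rot :: "'d \<Rightarrow> 'd"
  opp :: "'d \<Rightarrow> 'd"

definition face_perm :: "('d, 'z) rot_system_scheme \<Rightarrow> 'd \<Rightarrow> 'd" where
  "face_perm m = rot m \<circ> opp m"

definition src :: "('d, 'z) rot_system_scheme \<Rightarrow> 'd \<Rightarrow> 'd set" where
  "src m d = orbit (rot m) d"

definition tgt :: "('d, 'z) rot_system_scheme \<Rightarrow> 'd \<Rightarrow> 'd set" where
  "tgt m d = src m (opp m d)"

definition edge :: "('d, 'z) rot_system_scheme \<Rightarrow> 'd \<Rightarrow> 'd set" where
  "edge m d = {d, opp m d}"

definition face :: "('d, 'z) rot_system_scheme \<Rightarrow> 'd \<Rightarrow> 'd set" where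
  "face m d = orbit (face_perm m) d"

definition vertices :: "('d, 'z) rot_system_scheme \<Rightarrow> 'd set set" where
  "vertices m = src m ` darts m"

definition edges :: "('d, 'z) rot_system_scheme \<Rightarrow> 'd set set" where
  "edges m = edge m ` darts m"

definition faces :: "('d, 'z) rot_system_scheme \<Rightarrow> 'd set set" where
  "faces m = face m ` darts m"

definition connected_darts :: "('d, 'z) rot_system_scheme \<Rightarrow> bool" where
  "connected_darts m \<longleftrightarrow>
     (\<forall>d\<in>darts m. \<forall>e\<in>darts m.
        (d, e) \<in> ({(x, rot m x) | x. x \<in> darts m} \<union> {(x, opp m x) | x. x \<in> darts m})\<^sup>*)"

text \<open>Finite connected maps with at least one edge.\<close>

definition is_map :: "('d, 'z) rot_system_scheme \<Rightarrow> bool" where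
  "is_map m \<longleftrightarrow> finite (darts m) \<and> darts m \<noteq> {} \<and>
     rot m permutes darts m \<and> opp m permutes darts m \<and>
     (\<forall>d\<in>darts m. opp m d \<noteq> d \<and> opp m (opp m d) = d) \<and>
     connected_darts m"

definition has_genus :: "('d, 'z) rot_system_scheme \<Rightarrow> nat \<Rightarrow> bool" where
  "has_genus m g \<longleftrightarrow>
     int (card (vertices m)) - int (card (edges m)) + int (card (faces m)) = 2 - 2 * int g"

text \<open>
  Distinctness of edges only matters for length 2, where it excludes running back and forth along
  one edge. A loop is a simple cycle of length 1.
\<close>

definition simple_cycle :: "('d, 'z) rot_system_scheme \<Rightarrow> 'd list \<Rightarrow> bool" where
  "simple_cycle m c \<longleftrightarrow> c \<noteq> [] \<and> set c \<subseteq> darts m \<and>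
     (\<forall>i<length c. tgt m (c ! i) = src m (c ! (Suc i mod length c))) \<and>
     distinct (map (src m) c) \<and> distinct (map (edge m) c)"

text \<open>The girth of a map without cycles is \<open>\<infinity>\<close>.\<close>

definition girth :: "('d, 'z) rot_system_scheme \<Rightarrow> enat" where
  "girth m = (INF c \<in> {c. simple_cycle m c}. enat (length c))"

text \<open>
  \<open>irreducible_map m b\<close> is \<open>2b\<close>-irreducibility. The boundary of a face is the cycle formed by its
  darts, which a given cycle may traverse in either direction.
\<close>

definition irreducible_map :: "('d, 'z) rot_system_scheme \<Rightarrow> nat \<Rightarrow> bool" where
  "irreducible_map m b \<longleftrightarrow>
     (\<forall>c. simple_cycle m c \<longrightarrow> 2 * b \<le> length c) \<and>
     (\<forall>c. simple_cycle m c \<and> length c = 2 * b \<longrightarrow>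
        (\<exists>F\<in>faces m. card F = 2 * b \<and> (F = set c \<or> F = opp m ` set c)))"

text \<open>
  The lift of a map to the universal cover of its surface, as the usual space of homotopy classes
  of paths from a base vertex. Since all faces are disks, homotopy of paths in the graph within the
  surface is generated by removing or inserting spurs and face contours.
\<close>

primrec walk :: "('d, 'z) rot_system_scheme \<Rightarrow> 'd set \<Rightarrow> 'd list \<Rightarrow> bool" where
  "walk m v [] \<longleftrightarrow> True"
| "walk m v (d # p) \<longleftrightarrow> d \<in> darts m \<and> src m d = v \<and> walk m (tgt m d) p"

definition contour :: "('d, 'z) rot_system_scheme \<Rightarrow> 'd \<Rightarrow> 'd list" where
  "contour m d = map (\<lambda>k. (face_perm m ^^ k) d) [0..<card (face m d)]"

inductive homotopic :: "('d, 'z) rot_system_scheme \<Rightarrow> 'd set \<Rightarrow> 'd list \<Rightarrow> 'd list \<Rightarrow> bool"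
  for m v where
  refl: "walk m v p \<Longrightarrow> homotopic m v p p"
| sym: "homotopic m v p q \<Longrightarrow> homotopic m v q p"
| trans: "homotopic m v p q \<Longrightarrow> homotopic m v q r \<Longrightarrow> homotopic m v p r"
| spur: "walk m v (p @ [d, opp m d] @ q) \<Longrightarrow> homotopic m v (p @ [d, opp m d] @ q) (p @ q)"
| disk: "walk m v (p @ contour m d @ q) \<Longrightarrow> homotopic m v (p @ contour m d @ q) (p @ q)"

definition hclass :: "('d, 'z) rot_system_scheme \<Rightarrow> 'd set \<Rightarrow> 'd list \<Rightarrow> 'd list set" where
  "hclass m v p = {q. homotopic m v p q}"

text \<open>
  A dart of the cover is a dart \<open>d\<close> of \<open>m\<close> together with a homotopy class \<open>C\<close> of paths from the base
  vertex \<open>v\<close> to the initial vertex of \<open>d\<close>. Reversing it moves the class along \<open>d\<close>.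
\<close>

definition universal_cover ::
  "('d, 'z) rot_system_scheme \<Rightarrow> 'd set \<Rightarrow> ('d list set \<times> 'd) rot_system" where
  "universal_cover m v =
     \<lparr> darts = {(hclass m v p, d) | p d. walk m v (p @ [d])},
       rot = (\<lambda>(C, d). (C, rot m d)),
       opp = (\<lambda>(C, d). (\<Union>p\<in>C. hclass m v (p @ [d]), opp m d)) \<rparr>"

definition base_vertex :: "('d, 'z) rot_system_scheme \<Rightarrow> 'd set" where
  "base_vertex m = (SOME v. v \<in> vertices m)"

definition essential_girth :: "('d, 'z) rot_system_scheme \<Rightarrow> enat" where
  "essential_girth m =
     (if has_genus m 0 then girth m else girth (universal_cover m (base_vertex m)))"

definition essentially_irreducible :: "('d, 'z) rot_system_scheme \<Rightarrow> nat \<Rightarrow> bool" where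
  "essentially_irreducible m b \<longleftrightarrow>
     (if has_genus m 0 then irreducible_map m b
      else irreducible_map (universal_cover m (base_vertex m)) b)"

text \<open>A labeling of the faces is recorded as the induced labeling of their darts.\<close>

record 'd labeled_map = "'d rot_system" +
  label :: "'d \<Rightarrow> nat"

definition faces_labeled :: "('d, 'z) labeled_map_scheme \<Rightarrow> nat \<Rightarrow> bool" where
  "faces_labeled m n \<longleftrightarrow> label m ` darts m = {1..n} \<and>
     (\<forall>d\<in>darts m. \<forall>e\<in>darts m. label m d = label m e \<longleftrightarrow> face m d = face m e)"

definition is_iso :: "('d \<Rightarrow> 'e) \<Rightarrow> 'd labeled_map \<Rightarrow> 'e labeled_map \<Rightarrow> bool" where
  "is_iso f m m' \<longleftrightarrow> bij_betw f (darts m) (darts m') \<and>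
     (\<forall>d\<in>darts m. f (rot m d) = rot m' (f d) \<and> f (opp m d) = opp m' (f d) \<and>
        label m' (f d) = label m d)"

definition Aut :: "'d labeled_map \<Rightarrow> ('d \<Rightarrow> 'd) set" where
  "Aut m = {f. f permutes darts m \<and> is_iso f m m}"

text \<open>
  Maps are considered up to isomorphism, so \<open>\<parallel>M\<parallel>\<close> is a sum over isomorphism classes. Natural numbers
  suffice as darts to represent every finite map.
\<close>

definition iso_rel :: "nat labeled_map set \<Rightarrow> (nat labeled_map \<times> nat labeled_map) set" where
  "iso_rel M = {(m, m'). m \<in> M \<and> m' \<in> M \<and> (\<exists>f. is_iso f m m')}"

definition weighted_count :: "nat labeled_map set \<Rightarrow> real" where
  "weighted_count M = (\<Sum>C \<in> M // iso_rel M. 1 / real (card (Aut (SOME m. m \<in> C))))"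

definition maps :: "nat \<Rightarrow> nat \<Rightarrow> (nat \<Rightarrow> nat) \<Rightarrow> nat labeled_map set" where
  "maps g n l = {m. is_map m \<and> has_genus m g \<and> faces_labeled m n \<and>
     (\<forall>d\<in>darts m. card (face m d) = 2 * l (label m d)) \<and>
     (\<forall>v\<in>vertices m. card v \<noteq> 1)}"

definition M_hat :: "nat \<Rightarrow> nat \<Rightarrow> nat \<Rightarrow> (nat \<Rightarrow> nat) \<Rightarrow> nat labeled_map set" where
  "M_hat b g n l = {m \<in> maps g n l. essentially_irreducible m b}"

definition G_hat_ge :: "nat \<Rightarrow> nat \<Rightarrow> nat \<Rightarrow> (nat \<Rightarrow> nat) \<Rightarrow> nat labeled_map set" where
  "G_hat_ge b g n l = {m \<in> maps g n l. essential_girth m \<ge> enat (2 * b)}"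

definition G_hat :: "nat \<Rightarrow> nat \<Rightarrow> nat \<Rightarrow> (nat \<Rightarrow> nat) \<Rightarrow> nat labeled_map set" where
  "G_hat b g n l = {m \<in> G_hat_ge b g n l. essential_girth m = enat (2 * b)}"

text \<open>
  Multivariate real polynomials in indeterminates numbered by \<open>nat\<close>: finitely supported maps from
  exponent vectors to coefficients.
\<close>

type_synonym mpoly = "(nat \<Rightarrow>\<^sub>0 nat) \<Rightarrow>\<^sub>0 real"

definition mpoly_eval :: "mpoly \<Rightarrow> (nat \<Rightarrow> real) \<Rightarrow> real" where
  "mpoly_eval P x =
     (\<Sum>e \<in> Poly_Mapping.keys P. Poly_Mapping.lookup P e *
        (\<Prod>i \<in> Poly_Mapping.keys e. x i ^ Poly_Mapping.lookup e i))"

definition mpoly_vars :: "mpoly \<Rightarrow> nat set" where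
  "mpoly_vars P = (\<Union>e \<in> Poly_Mapping.keys P. Poly_Mapping.keys e)"

text \<open>Indeterminate 0 stands for \<open>b\<close>, indeterminates \<open>1, \<dots>, n\<close> for the half-degrees.\<close>

definition point :: "real \<Rightarrow> (nat \<Rightarrow> real) \<Rightarrow> nat \<Rightarrow> real" where
  "point b l i = (if i = 0 then b else l i)"

text \<open>A polynomial in \<open>b\<close> and the squares of the half-degrees.\<close>

definition N_value :: "mpoly \<Rightarrow> real \<Rightarrow> (nat \<Rightarrow> nat) \<Rightarrow> real" where
  "N_value P b l = mpoly_eval P (point b (\<lambda>i. (real (l i))\<^sup>2))"

text \<open>
  The characterization of \<open>N_hat\<close> for given \<open>g\<close> and \<open>n\<close>, as one polynomial in \<open>b\<close> and the squares,
  symmetric in the latter. It determines the polynomial uniquely.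
\<close>

definition is_N_hat :: "nat \<Rightarrow> nat \<Rightarrow> mpoly \<Rightarrow> bool" where
  "is_N_hat g n P \<longleftrightarrow>
     mpoly_vars P \<subseteq> {0..n} \<and>
     (\<forall>\<pi> x. \<pi> permutes {1..n} \<longrightarrow> mpoly_eval P (x \<circ> \<pi>) = mpoly_eval P x) \<and>
     (\<forall>b l. (\<forall>i\<in>{1..n}. max b 1 \<le> l i) \<longrightarrow>
        weighted_count (M_hat b g n l) = N_value P (real b) l +
          (if g = 0 \<and> 4 \<le> n \<and> (\<forall>i\<in>{1..n}. l i = b)
           then fact (n - 1) / 2 * (- 1) ^ n else 0))"

end

theory Submission
  imports Defs
begin

text \<open>
  All faces have even degree, and the lift of the map lives on a simply connected surface, so the
  lift is bipartite and its cycles have even length. When no face has degree \<open>2 (b - 1)\<close>, essential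
  \<open>2 (b - 1)\<close>-irreducibility therefore says exactly that the essential girth is at least \<open>2 b\<close>. This
  gives the first count, and the maps of essential girth exactly \<open>2 b\<close> are counted by the difference
  of the counts for \<open>b\<close> and \<open>b + 1\<close>. The latter count vanishes as soon as some face has degree \<open>2 b\<close>:
  without vertices of degree one the contour of that face is a closed walk without backtracking in
  the lift, hence contains a simple cycle.
\<close>

section \<open>Rotation systems\<close>

locale rotation =
  fixes X :: "('d, 'z) rot_system_scheme"
  assumes rot_closed: "d \<in> darts X \<Longrightarrow> rot X d \<in> darts X"
    and opp_closed: "d \<in> darts X \<Longrightarrow> opp X d \<in> darts X"
    and opp_neq: "d \<in> darts X \<Longrightarrow> opp X d \<noteq> d"
    and opp_opp: "d \<in> darts X \<Longrightarrow> opp X (opp X d) = d"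
    and in_src: "d \<in> darts X \<Longrightarrow> d \<in> src X d"
begin

lemma src_invariant:
  assumes "\<And>d. d \<in> darts X \<Longrightarrow> h (rot X d) = h d" "d \<in> darts X" "e \<in> src X d"
  shows "e \<in> darts X \<and> h e = h d"
  using assms(3) unfolding src_def
  by induction (use assms(1,2) in \<open>auto simp: rot_closed\<close>)

lemma src_subset: "d \<in> darts X \<Longrightarrow> src X d \<subseteq> darts X"
  using src_invariant[of "\<lambda>_. True"] by auto

lemma src_rot: "d \<in> darts X \<Longrightarrow> src X (rot X d) = src X d"
  using in_src unfolding src_def by (rule self_in_orbit_step)

lemma tgt_opp: "d \<in> darts X \<Longrightarrow> tgt X (opp X d) = src X d"
  by (simp add: tgt_def opp_opp)

lemma face_perm_closed: "d \<in> darts X \<Longrightarrow> face_perm X d \<in> darts X"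
  by (simp add: face_perm_def rot_closed opp_closed)

lemma face_perm_funpow_closed: "d \<in> darts X \<Longrightarrow> (face_perm X ^^ k) d \<in> darts X"
  by (induction k) (auto simp: face_perm_closed)

lemma src_face_perm: "d \<in> darts X \<Longrightarrow> src X (face_perm X d) = tgt X d"
  by (simp add: face_perm_def tgt_def src_rot opp_closed)

lemma even_simple_cycle:
  assumes rot: "\<And>d. d \<in> darts X \<Longrightarrow> h (rot X d) = h d"
    and opp: "\<And>d. d \<in> darts X \<Longrightarrow> h (opp X d) = (\<not> h d)"
    and c: "simple_cycle X c"
  shows "even (length c)"
proof -
  let ?L = "length c"
  have L: "0 < ?L" using c by (auto simp: simple_cycle_def)
  have dart: "c ! i \<in> darts X" if "i < ?L" for i
    using c that by (auto simp: simple_cycle_def)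
  have step: "h (c ! (Suc i mod ?L)) = (\<not> h (c ! i))" if i: "i < ?L" for i
  proof -
    have j: "Suc i mod ?L < ?L" using L by simp
    have "src X (opp X (c ! i)) = src X (c ! (Suc i mod ?L))"
      using c i by (simp add: simple_cycle_def tgt_def)
    then have "c ! (Suc i mod ?L) \<in> src X (opp X (c ! i))"
      using in_src[OF dart[OF j]] by simp
    then show ?thesis
      using src_invariant[of h, OF rot opp_closed[OF dart[OF i]]] opp[OF dart[OF i]] by simp
  qed
  have alt: "i < ?L \<Longrightarrow> h (c ! i) = (h (c ! 0) = even i)" for i
  proof (induction i)
    case (Suc i)
    then show ?case using step[of i] by auto
  qed simp
  show ?thesis
    using step[of "?L - 1"] alt[of "?L - 1"] L by auto
qed

lemma short_simple_cycle:
  assumes w: "\<And>k. w k \<in> darts X" "\<And>k. src X (w (Suc k)) = tgt X (w k)"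
      "\<And>k. w (Suc k) \<noteq> opp X (w k)"
    and L: "0 < L" "src X (w L) = src X (w 0)"
  shows "\<exists>c. simple_cycle X c \<and> length c \<le> L"
proof -
  define P where "P j \<longleftrightarrow> (\<exists>i<j. src X (w i) = src X (w j))" for j
  have "P L" unfolding P_def using L by (intro exI[of _ 0]) auto
  define j where "j = (LEAST j. P j)"
  have "P j" "j \<le> L" unfolding j_def using \<open>P L\<close> by (auto intro: LeastI Least_le)
  then obtain i where i: "i < j" "src X (w i) = src X (w j)" by (auto simp: P_def)
  have min: "src X (w a) \<noteq> src X (w b)" if "a < b" "b < j" for a b
    using not_less_Least[of b P] that unfolding j_def P_def by blast
  have edge: "edge X (w a) \<noteq> edge X (w b)" if "a < b" "b < j" for a b
  proof
    assume "edge X (w a) = edge X (w b)"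
    moreover have "w a \<noteq> w b" using min[OF that] by auto
    ultimately have "w b = opp X (w a)" by (auto simp: edge_def doubleton_eq_iff)
    then have "src X (w b) = src X (w (Suc a))" by (simp add: w(2) tgt_def)
    then have "b = Suc a" using min[of "Suc a" b] that by fastforce
    then show False using \<open>w b = opp X (w a)\<close> w(3) by simp
  qed
  define c where "c = map w [i..<j]"
  have nth: "c ! k = w (i + k)" if "k < j - i" for k using that by (simp add: c_def)
  have len: "length c = j - i" by (simp add: c_def)
  have "tgt X (c ! k) = src X (c ! (Suc k mod length c))" if k: "k < length c" for k
  proof (cases "Suc k = length c")
    case True
    then have "tgt X (c ! k) = src X (w j)"
      using w(2)[of "i + k"] i(1) by (simp add: nth len) (metis add_Suc_right le_add_diff_inverse less_imp_le)
    then show ?thesis using True i nth[of 0] by simp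
  next
    case False
    then show ?thesis using k w(2)[of "i + k"] by (simp add: nth len)
  qed
  moreover have "distinct (map (src X) c)"
    unfolding distinct_conv_nth using min
    by (auto simp: len nth) (metis less_diff_conv add.commute nat_add_left_cancel_less nat_neq_iff)
  moreover have "distinct (map (edge X) c)"
    unfolding distinct_conv_nth using edge
    by (auto simp: len nth) (metis less_diff_conv add.commute nat_add_left_cancel_less nat_neq_iff)
  ultimately have "simple_cycle X c"
    using i(1) w(1) by (auto simp: simple_cycle_def c_def)
  then show ?thesis using \<open>j \<le> L\<close> len by auto
qed

end

definition rot_embedding ::
  "('d \<Rightarrow> 'e) \<Rightarrow> ('d, 'y) rot_system_scheme \<Rightarrow> ('e, 'z) rot_system_scheme \<Rightarrow> bool" where
  "rot_embedding f X Y \<longleftrightarrow> inj_on f (darts X) \<and> f ` darts X \<subseteq> darts Y \<and>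
     (\<forall>d\<in>darts X. f (rot X d) = rot Y (f d) \<and> f (opp X d) = opp Y (f d))"

context rotation begin

lemma embedding_src:
  assumes "rot_embedding f X Y" "d \<in> darts X"
  shows "src Y (f d) = f ` src X d"
  unfolding src_def
proof (rule orbit_inverse[symmetric])
  show "d \<in> orbit (rot X) d" using in_src[OF assms(2)] by (simp add: src_def)
  show "rot Y (f x) = f (rot X x)" if "x \<in> orbit (rot X) d" for x
    using that assms src_subset[OF assms(2)] by (auto simp: rot_embedding_def src_def)
qed

lemma embedding_tgt:
  assumes "rot_embedding f X Y" "d \<in> darts X"
  shows "tgt Y (f d) = f ` tgt X d"
  using embedding_src[OF assms(1) opp_closed[OF assms(2)]] assms
  by (simp add: tgt_def rot_embedding_def)

lemma embedding_simple_cycle: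
  assumes f: "rot_embedding f X Y" and c: "simple_cycle X c"
  shows "simple_cycle Y (map f c)"
proof -
  have inj: "inj_on f (darts X)" using f by (simp add: rot_embedding_def)
  have sub: "set c \<subseteq> darts X" using c by (simp add: simple_cycle_def)
  have image_eq: "f ` A = f ` B \<longleftrightarrow> A = B" if "A \<subseteq> darts X" "B \<subseteq> darts X" for A B
    using inj_on_image_eq_iff[OF inj that] .
  have edge: "edge Y (f d) = f ` edge X d" if "d \<in> darts X" for d
    using f that by (auto simp: edge_def rot_embedding_def)
  have edge_sub: "edge X d \<subseteq> darts X" if "d \<in> darts X" for d
    using that opp_closed by (auto simp: edge_def)
  have "tgt Y (f (c ! i)) = src Y (f (c ! (Suc i mod length c)))" if "i < length c" for i
  proof -
    have "c ! i \<in> darts X" "c ! (Suc i mod length c) \<in> darts X"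
      using that sub by (auto intro!: subsetD[OF sub] nth_mem mod_less_divisor)
    then show ?thesis using c that
      by (simp add: embedding_src[OF f] embedding_tgt[OF f] simple_cycle_def)
  qed
  moreover have "Suc i mod length c < length c" if "i < length c" for i
    using that by (intro mod_less_divisor) auto
  moreover have "distinct (map (src Y \<circ> f) c)"
  proof -
    have "inj_on (src Y \<circ> f) (set c)"
    proof (rule inj_onI)
      fix d e assume de: "d \<in> set c" "e \<in> set c" "(src Y \<circ> f) d = (src Y \<circ> f) e"
      then have "f ` src X d = f ` src X e"
        using embedding_src[OF f, of d] embedding_src[OF f, of e] subsetD[OF sub] by simp
      then have "src X d = src X e"
        using image_eq[OF src_subset src_subset] sub de by blast
      then show "d = e" using de c by (auto simp: simple_cycle_def distinct_map inj_on_def)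
    qed
    then show ?thesis using c by (simp add: simple_cycle_def distinct_map)
  qed
  moreover have "distinct (map (edge Y \<circ> f) c)"
  proof -
    have "inj_on (edge Y \<circ> f) (set c)"
    proof (rule inj_onI)
      fix d e assume de: "d \<in> set c" "e \<in> set c" "(edge Y \<circ> f) d = (edge Y \<circ> f) e"
      then have "f ` edge X d = f ` edge X e" using de(3) edge[of d] edge[of e] subsetD[OF sub] de(1,2) by simp
      then have "edge X d = edge X e"
        using image_eq[OF edge_sub edge_sub] sub de by blast
      then show "d = e" using de c by (auto simp: simple_cycle_def distinct_map inj_on_def)
    qed
    then show ?thesis using c by (simp add: simple_cycle_def distinct_map)
  qed
  ultimately show ?thesis
    using c f sub by (auto simp: simple_cycle_def rot_embedding_def image_subset_iff subset_iff)
qed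

lemma embedding_girth:
  assumes "rot_embedding f X Y"
  shows "girth Y \<le> girth X"
  unfolding girth_def
proof (rule INF_greatest)
  fix c assume "c \<in> {c. simple_cycle X c}"
  then show "(INF c\<in>{c. simple_cycle Y c}. enat (length c)) \<le> enat (length c)"
    using embedding_simple_cycle[OF assms] by (intro INF_lower2[of "map f c"]) auto
qed

end

lemma girth_ge_iff: "enat k \<le> girth X \<longleftrightarrow> (\<forall>c. simple_cycle X c \<longrightarrow> k \<le> length c)"
  by (auto simp: girth_def le_INF_iff)

lemma girth_eq_iff:
  "girth X = enat k \<longleftrightarrow> enat k \<le> girth X \<and> \<not> enat (Suc k) \<le> girth X"
  by (metis Suc_ile_eq less_le not_le)

locale finite_map =
  fixes m :: "('d, 'z) rot_system_scheme"
  assumes is_map: "is_map m"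
begin

lemma finite_darts: "finite (darts m)"
  and rot_permutes: "rot m permutes darts m"
  and opp_permutes: "opp m permutes darts m"
  and connected: "connected_darts m"
  using is_map by (auto simp: is_map_def)

sublocale rotation m
proof
  fix d assume d: "d \<in> darts m"
  show "d \<in> src m d"
    unfolding src_def
    using rot_permutes finite_darts by (intro permutation_self_in_orbit) (auto simp: permutation_permutes)
qed (use is_map in \<open>auto simp: is_map_def permutes_in_image\<close>)

lemma face_perm_permutes: "face_perm m permutes darts m"
  unfolding face_perm_def using opp_permutes rot_permutes by (rule permutes_compose)

lemma in_face: "d \<in> face m d"
  unfolding face_def
  using face_perm_permutes finite_darts
  by (intro permutation_self_in_orbit) (auto simp: permutation_permutes)

lemma face_subset: "d \<in> darts m \<Longrightarrow> face m d \<subseteq> darts m"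
  unfolding face_def by (rule permutes_orbit_subset[OF face_perm_permutes])

lemma finite_face: "finite (face m d)"
  using in_face unfolding face_def by (rule finite_orbit)

lemma face_eq_iff: "face m d = face m e \<longleftrightarrow> e \<in> face m d"
  using in_face unfolding face_def by (metis cyclic_on_singleI orbit_cyclic_eq3)

lemma face_face_perm: "face m (face_perm m d) = face m d"
  using in_face unfolding face_def by (rule self_in_orbit_step)

lemma card_face_pos: "0 < card (face m d)"
  using in_face finite_face by (auto simp: card_gt_0_iff)

lemma face_perm_funpow_card: "(face_perm m ^^ card (face m d)) d = d"
proof -
  define P where "P n \<longleftrightarrow> 0 < n \<and> (face_perm m ^^ n) d = d" for n
  have "d \<in> {(face_perm m ^^ n) d | n. 0 < n}"
    using in_face by (simp only: face_def orbit_altdef)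
  then obtain n0 where n0: "d = (face_perm m ^^ n0) d" "0 < n0" by blast
  define n where "n = (LEAST n. P n)"
  have "P n0" using n0 by (simp add: P_def)
  then have "P n" unfolding n_def by (rule LeastI)
  then have n: "0 < n" "(face_perm m ^^ n) d = d" by (auto simp: P_def)
  have min: "(face_perm m ^^ k) d \<noteq> d" if "0 < k" "k < n" for k
    using not_less_Least[of k P] that by (auto simp: n_def P_def)
  have inj: "inj (face_perm m ^^ k)" for k
    using face_perm_permutes by (intro inj_fn permutes_inj)
  have "inj_on (\<lambda>k. (face_perm m ^^ k) d) {..<n}"
  proof (rule linorder_inj_onI')
    fix i j assume ij: "i \<in> {..<n}" "j \<in> {..<n}" "i < j"
    show "(face_perm m ^^ i) d \<noteq> (face_perm m ^^ j) d"
    proof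
      assume "(face_perm m ^^ i) d = (face_perm m ^^ j) d"
      then have "(face_perm m ^^ i) d = (face_perm m ^^ i) ((face_perm m ^^ (j - i)) d)"
        using ij by (simp flip: funpow_add[THEN fun_cong, unfolded o_apply])
      then have "(face_perm m ^^ (j - i)) d = d"
        using inj[of i] by (metis injD)
      moreover have "0 < j - i" "j - i < n" using ij by auto
      ultimately show False using min by blast
    qed
  qed
  moreover have "face m d = (\<lambda>k. (face_perm m ^^ k) d) ` {..<n}"
    unfolding face_def orbit_altdef_bounded[OF n(2,1)] by auto
  ultimately have "card (face m d) = n" by (simp add: card_image)
  then show ?thesis using n by simp
qed

lemma connected_induct:
  assumes "d \<in> darts m" "e \<in> darts m" "R d"
    and rot: "\<And>x. x \<in> darts m \<Longrightarrow> R x \<Longrightarrow> R (rot m x)"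
    and opp: "\<And>x. x \<in> darts m \<Longrightarrow> R x \<Longrightarrow> R (opp m x)"
  shows "R e"
proof -
  have "(d, e) \<in> ({(x, rot m x) | x. x \<in> darts m} \<union> {(x, opp m x) | x. x \<in> darts m})\<^sup>*"
    using connected assms(1,2) by (auto simp: connected_darts_def)
  then show ?thesis by induction (use assms in auto)
qed

lemma no_leaf_turn:
  assumes "\<forall>v\<in>vertices m. card v \<noteq> 1" "d \<in> darts m"
  shows "face_perm m d \<noteq> opp m d"
proof
  assume "face_perm m d = opp m d"
  then have "src m (opp m d) = {opp m d}"
    by (simp add: src_def face_perm_def orbit_eq_singleton_iff)
  moreover have "src m (opp m d) \<in> vertices m" using assms(2) opp_closed by (simp add: vertices_def)
  ultimately show False using assms(1) by auto
qed

end

section \<open>Planar maps with even faces are bipartite\<close>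

lemma sym_diff_iff: "x \<in> sym_diff A B \<longleftrightarrow> (x \<in> A) \<noteq> (x \<in> B)"
  by auto

lemma odd_card_sym_diff:
  assumes "finite A" "finite B"
  shows "odd (card (sym_diff A B)) \<longleftrightarrow> odd (card A) \<noteq> odd (card B)"
proof -
  have "card (sym_diff A B) = card (A - B) + card (B - A)"
    using assms by (intro card_Un_disjoint) auto
  moreover have "card A = card (A - B) + card (A \<inter> B)" "card B = card (B - A) + card (A \<inter> B)"
    using assms by (metis Int_commute card_Diff_subset_Int card_mono Int_lower1 finite_Int le_add_diff_inverse2)+
  ultimately show ?thesis by presburger
qed

text \<open>
  Over the field with two elements, the coboundary \<open>cut\<close> has rank \<open>V - 1\<close> and \<open>boundary\<close>, its successor in
  the cochain complex of the sphere, has rank \<open>F - 1\<close>. As \<open>E = (V - 1) + (F - 1)\<close>, every set of edges in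
  the kernel of \<open>boundary\<close> is a cut; if the faces are even, the set of all edges is such a set. Vector
  spaces are sets under symmetric difference, and dimensions are replaced by cardinalities.
\<close>

locale even_planar_map = finite_map +
  assumes planar: "has_genus m 0"
    and even_faces: "\<And>d. d \<in> darts m \<Longrightarrow> even (card (face m d))"
begin

definition cut :: "'a set set \<Rightarrow> 'a set set" where
  "cut S = {edge m d | d. d \<in> darts m \<and> (src m d \<in> S) \<noteq> (tgt m d \<in> S)}"

definition boundary :: "'a set set \<Rightarrow> 'a set set" where
  "boundary A = {f \<in> faces m. odd (card {d \<in> f. edge m d \<in> A})}"

lemma finite_cells: "finite (vertices m)" "finite (edges m)" "finite (faces m)"
  using finite_darts by (auto simp: vertices_def edges_def faces_def)

lemma edge_eq_iff:
  assumes "d \<in> darts m" "e \<in> darts m"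
  shows "edge m d = edge m e \<longleftrightarrow> e = d \<or> e = opp m d"
  using assms opp_opp by (auto simp: edge_def doubleton_eq_iff)

lemma edge_in_cut_iff:
  assumes "d \<in> darts m"
  shows "edge m d \<in> cut S \<longleftrightarrow> (src m d \<in> S) \<noteq> (tgt m d \<in> S)"
proof
  assume "edge m d \<in> cut S"
  then obtain e where e: "edge m d = edge m e" "e \<in> darts m" "(src m e \<in> S) \<noteq> (tgt m e \<in> S)"
    by (auto simp: cut_def)
  then show "(src m d \<in> S) \<noteq> (tgt m d \<in> S)"
    using assms edge_eq_iff[of d e] tgt_opp[of d] by (auto simp: tgt_def opp_opp)
qed (use assms in \<open>auto simp: cut_def\<close>)

lemma faceE:
  assumes "f \<in> faces m" obtains "finite f" "f \<subseteq> darts m" "bij_betw (face_perm m) f f"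
proof -
  obtain d where d: "d \<in> darts m" "f = face m d" using assms by (auto simp: faces_def)
  have inj: "inj_on (face_perm m) f"
    using permutes_inj[OF face_perm_permutes] by (rule inj_on_subset) simp
  have fin: "finite f" using d finite_face by simp
  have "face_perm m ` f \<subseteq> f" using d by (auto simp: face_def intro: orbit.step)
  then have "bij_betw (face_perm m) f f"
    using inj fin by (simp add: bij_betw_def endo_inj_surj)
  then show ?thesis using that fin d face_subset by simp
qed

lemma boundary_cut: "boundary (cut S) = {}"
proof -
  have "even (card {d \<in> f. edge m d \<in> cut S})" if f: "f \<in> faces m" for f
  proof -
    obtain fin: "finite f" and sub: "f \<subseteq> darts m" and bij: "bij_betw (face_perm m) f f"
      using f by (rule faceE)
    let ?A = "{d \<in> f. src m d \<in> S}" and ?B = "{d \<in> f. tgt m d \<in> S}"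
    have "face_perm m ` ?B = ?A"
    proof -
      have "?A = {d \<in> face_perm m ` f. src m d \<in> S}" using bij by (simp add: bij_betw_def)
      then show ?thesis using sub src_face_perm by auto
    qed
    then have "card ?A = card ?B"
      using bij by (metis (no_types, lifting) card_image bij_betw_def inj_on_subset mem_Collect_eq subsetI)
    moreover have "{d \<in> f. edge m d \<in> cut S} = sym_diff ?A ?B"
      using sub edge_in_cut_iff by auto
    ultimately show ?thesis
      using odd_card_sym_diff[of ?A ?B] fin by simp
  qed
  then show ?thesis by (auto simp: boundary_def)
qed

lemma boundary_sym_diff: "boundary (sym_diff A B) = sym_diff (boundary A) (boundary B)"
proof -
  have "odd (card {d \<in> f. edge m d \<in> sym_diff A B}) \<longleftrightarrow>
      odd (card {d \<in> f. edge m d \<in> A}) \<noteq> odd (card {d \<in> f. edge m d \<in> B})"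
    if "f \<in> faces m" for f
  proof -
    have "{d \<in> f. edge m d \<in> sym_diff A B} =
        sym_diff {d \<in> f. edge m d \<in> A} {d \<in> f. edge m d \<in> B}" by auto
    moreover have "finite f" using that by (rule faceE)
    ultimately show ?thesis
      using odd_card_sym_diff[of "{d \<in> f. edge m d \<in> A}" "{d \<in> f. edge m d \<in> B}"] by simp
  qed
  then show ?thesis unfolding boundary_def by auto
qed

lemma boundary_edge:
  assumes "d \<in> darts m"
  shows "boundary {edge m d} = sym_diff {face m d} {face m (opp m d)}"
proof -
  have "odd (card {e \<in> f. edge m e \<in> {edge m d}}) \<longleftrightarrow> (f = face m d) \<noteq> (f = face m (opp m d))"
    if f: "f \<in> faces m" for f
  proof -
    have mem: "e \<in> f \<longleftrightarrow> f = face m e" for e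
      using f face_eq_iff by (auto simp: faces_def in_face)
    have "{e \<in> f. edge m e \<in> {edge m d}} = {e \<in> {d, opp m d}. f = face m e}"
    proof -
      have "f \<subseteq> darts m" using f by (rule faceE)
      then have "e \<in> f \<Longrightarrow> edge m e = edge m d \<longleftrightarrow> e = d \<or> e = opp m d" for e
        using edge_eq_iff[OF assms, of e] by (metis subsetD)
      then show ?thesis unfolding mem[symmetric] by blast
    qed
    moreover have "card {e \<in> {d, opp m d}. f = face m e} =
        (if f = face m d then 1 else 0) + (if f = face m (opp m d) then 1 else 0)"
    proof -
      have "{e \<in> {d, opp m d}. f = face m e} =
          (if f = face m d then {d} else {}) \<union> (if f = face m (opp m d) then {opp m d} else {})" by auto
      then show ?thesis using opp_neq[OF assms] by (simp add: card_insert_if)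
    qed
    ultimately show ?thesis by simp
  qed
  moreover have "face m d \<in> faces m" "face m (opp m d) \<in> faces m"
    using assms opp_closed by (auto simp: faces_def)
  ultimately show ?thesis unfolding boundary_def by auto
qed

lemma base_dart: obtains d0 where "d0 \<in> darts m"
  using is_map by (auto simp: is_map_def)

lemma card_edges_plus: "card (edges m) + 2 = card (vertices m) + card (faces m)"
  using planar by (simp add: has_genus_def)

lemma inj_cut:
  assumes "d0 \<in> darts m"
  shows "inj_on cut (Pow (vertices m - {src m d0}))"
proof (rule inj_onI)
  fix S T assume S: "S \<in> Pow (vertices m - {src m d0})" and T: "T \<in> Pow (vertices m - {src m d0})"
    and eq: "cut S = cut T"
  have "(src m e \<in> S) = (src m e \<in> T)" if "e \<in> darts m" for e
  proof (rule connected_induct[OF assms that])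
    show "(src m d0 \<in> S) = (src m d0 \<in> T)" using S T by blast
    show "(src m (opp m x) \<in> S) = (src m (opp m x) \<in> T)"
      if "x \<in> darts m" "(src m x \<in> S) = (src m x \<in> T)" for x
      using that eq edge_in_cut_iff[of x S] edge_in_cut_iff[of x T] by (auto simp: tgt_def)
  qed (simp add: src_rot)
  then have "v \<in> S \<longleftrightarrow> v \<in> T" if "v \<in> vertices m" for v using that by (auto simp: vertices_def)
  then show "S = T" using S T by blast
qed

lemma boundary_spans:
  assumes "d0 \<in> darts m" "S \<subseteq> faces m - {face m d0}"
  shows "\<exists>A\<in>Pow (edges m). boundary A - {face m d0} = S"
proof -
  have pair: "\<exists>A\<in>Pow (edges m). boundary A = sym_diff {face m d0} {face m e}"
    if "e \<in> darts m" for e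
  proof (rule connected_induct[OF assms(1) that])
    show "\<exists>A\<in>Pow (edges m). boundary A = sym_diff {face m d0} {face m d0}"
      by (intro bexI[of _ "{}"]) (auto simp: boundary_def)
  next
    fix x assume x: "x \<in> darts m" "\<exists>A\<in>Pow (edges m). boundary A = sym_diff {face m d0} {face m x}"
    then obtain A where A: "A \<subseteq> edges m" "boundary A = sym_diff {face m d0} {face m x}" by auto
    have "boundary (sym_diff A {edge m x}) = sym_diff {face m d0} {face m (opp m x)}"
      unfolding boundary_sym_diff boundary_edge[OF x(1)] A(2) by auto
    moreover have "sym_diff A {edge m x} \<in> Pow (edges m)" using A x by (auto simp: edges_def)
    ultimately show opp: "\<exists>A\<in>Pow (edges m). boundary A = sym_diff {face m d0} {face m (opp m x)}"
      by blast
  next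
    fix x assume x: "x \<in> darts m" "\<exists>A\<in>Pow (edges m). boundary A = sym_diff {face m d0} {face m x}"
    then obtain A where A: "A \<subseteq> edges m" "boundary A = sym_diff {face m d0} {face m x}" by auto
    have o: "opp m x \<in> darts m" using x opp_closed by simp
    have "face m (rot m x) = face m (opp m x)"
      using face_face_perm[of "opp m x"] x(1) by (simp add: face_perm_def opp_opp)
    then have "boundary (sym_diff A {edge m x}) = sym_diff {face m d0} {face m (rot m x)}"
      unfolding boundary_sym_diff boundary_edge[OF x(1)] A(2) by auto
    moreover have "sym_diff A {edge m x} \<in> Pow (edges m)" using A x by (auto simp: edges_def)
    ultimately show "\<exists>A\<in>Pow (edges m). boundary A = sym_diff {face m d0} {face m (rot m x)}"
      by blast
  qed
  have "finite S" using assms(2) finite_cells(3) by (meson finite_Diff finite_subset)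
  then show ?thesis using assms(2)
  proof (induction S)
    case empty
    show ?case by (intro bexI[of _ "{}"]) (auto simp: boundary_def)
  next
    case (insert f S)
    then obtain A where A: "A \<subseteq> edges m" "boundary A - {face m d0} = S" by auto
    obtain e where e: "e \<in> darts m" "f = face m e" using insert.prems by (auto simp: faces_def)
    obtain B where B: "B \<subseteq> edges m" "boundary B = sym_diff {face m d0} {face m e}"
      using pair[OF e(1)] by auto
    have "boundary (sym_diff A B) - {face m d0} = insert f S"
      unfolding boundary_sym_diff B(2) e(2)[symmetric] A(2)[symmetric]
      using insert.hyps insert.prems A(2) by auto
    moreover have "sym_diff A B \<in> Pow (edges m)" using A B by auto
    ultimately show ?case by blast
  qed
qed

lemma card_kernel_boundary:
  "card {A \<in> Pow (edges m). boundary A = {}} \<le> 2 ^ (card (vertices m) - 1)"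
proof -
  obtain d0 where d0: "d0 \<in> darts m" by (rule base_dart)
  let ?K = "{A \<in> Pow (edges m). boundary A = {}}" and ?I = "boundary ` Pow (edges m)"
  have fin: "finite (Pow (edges m))" using finite_cells by simp
  have fibre: "card ?K \<le> card {A \<in> Pow (edges m). boundary A = T}" if T: "T \<in> ?I" for T
  proof -
    obtain A0 where A0: "A0 \<subseteq> edges m" "boundary A0 = T" using T by blast
    have inj: "inj_on (sym_diff A0) ?K"
    proof (rule inj_onI, rule set_eqI)
      fix A B x assume "sym_diff A0 A = sym_diff A0 B"
      then have "x \<in> sym_diff A0 A \<longleftrightarrow> x \<in> sym_diff A0 B" by simp
      then show "x \<in> A \<longleftrightarrow> x \<in> B" unfolding sym_diff_iff by blast
    qed
    have "sym_diff A0 ` ?K \<subseteq> {A \<in> Pow (edges m). boundary A = T}"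
    proof (rule image_subsetI)
      fix A assume "A \<in> ?K"
      then show "sym_diff A0 A \<in> {A \<in> Pow (edges m). boundary A = T}"
        using A0 boundary_sym_diff[of A0 A] by auto
    qed
    then show ?thesis using inj fin by (intro card_inj_on_le[of "sym_diff A0"]) auto
  qed
  have "card ?I * card ?K \<le> (\<Sum>T\<in>?I. card {A \<in> Pow (edges m). boundary A = T})"
    using fibre sum_bounded_below[of ?I "card ?K"] by simp
  also have "\<dots> = card (Pow (edges m))"
    using sum.image_gen[OF fin, of "\<lambda>_. 1::nat" boundary] by simp
  finally have mult: "card ?I * card ?K \<le> 2 ^ card (edges m)"
    using finite_cells by (simp add: card_Pow)
  have sub: "Pow (faces m - {face m d0}) \<subseteq> (\<lambda>T. T - {face m d0}) ` ?I"
  proof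
    fix S assume "S \<in> Pow (faces m - {face m d0})"
    then obtain A where "A \<in> Pow (edges m)" "boundary A - {face m d0} = S"
      using boundary_spans[OF d0] by blast
    then show "S \<in> (\<lambda>T. T - {face m d0}) ` ?I" by blast
  qed
  have finI: "finite ?I" using fin by (rule finite_imageI)
  have "card (Pow (faces m - {face m d0})) \<le> card ((\<lambda>T. T - {face m d0}) ` ?I)"
    using finite_imageI[OF finI] sub by (rule card_mono)
  also have "\<dots> \<le> card ?I" using finI by (rule card_image_le)
  finally have "card (Pow (faces m - {face m d0})) \<le> card ?I" .
  moreover have f0: "face m d0 \<in> faces m" "src m d0 \<in> vertices m"
    using d0 by (auto simp: faces_def vertices_def)
  ultimately have "2 ^ (card (faces m) - 1) \<le> card ?I"
    using finite_cells by (simp add: card_Pow)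
  then have "2 ^ (card (faces m) - 1) * card ?K \<le> 2 ^ card (edges m)"
    using mult mult_le_mono1 le_trans by blast
  moreover have "card (edges m) = (card (faces m) - 1) + (card (vertices m) - 1)"
    using card_edges_plus f0 finite_cells card_gt_0_iff[of "faces m"] card_gt_0_iff[of "vertices m"]
    by (cases "card (faces m)"; cases "card (vertices m)") auto
  ultimately show ?thesis by (simp add: power_add)
qed

lemma bipartite:
  obtains S where "\<And>d. d \<in> darts m \<Longrightarrow> (src m d \<in> S) \<noteq> (tgt m d \<in> S)"
proof -
  obtain d0 where d0: "d0 \<in> darts m" by (rule base_dart)
  let ?K = "{A \<in> Pow (edges m). boundary A = {}}" and ?V = "Pow (vertices m - {src m d0})"
  have fin: "finite ?K" using finite_cells by simp
  have v0: "src m d0 \<in> vertices m" using d0 by (auto simp: vertices_def)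
  have "card (cut ` ?V) = 2 ^ (card (vertices m) - 1)"
    using card_image[OF inj_cut[OF d0]] v0 finite_cells by (simp add: card_Pow)
  moreover have sub: "cut ` ?V \<subseteq> ?K"
    using boundary_cut by (auto simp: cut_def edges_def)
  ultimately have "cut ` ?V = ?K"
    using card_kernel_boundary fin by (intro card_seteq) auto
  moreover have "edges m \<in> ?K"
  proof -
    have "{d \<in> f. edge m d \<in> edges m} = f" if "f \<in> faces m" for f
      using faceE[OF that] by (auto simp: edges_def)
    then show ?thesis using even_faces by (auto simp: boundary_def faces_def)
  qed
  ultimately have "edges m \<in> cut ` ?V" by simp
  then obtain S where "cut S = edges m" by (metis imageE)
  then show ?thesis
    using that[of S] edge_in_cut_iff by (auto simp: edges_def)
qed

lemma even_planar_cycle: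
  assumes "simple_cycle m c" shows "even (length c)"
proof -
  obtain S where S: "\<And>d. d \<in> darts m \<Longrightarrow> (src m d \<in> S) \<noteq> (tgt m d \<in> S)"
    using bipartite by blast
  show ?thesis
  proof (rule even_simple_cycle[OF _ _ assms])
    show "(src m (rot m d) \<in> S) = (src m d \<in> S)" if "d \<in> darts m" for d
      using src_rot[OF that] by simp
    show "(src m (opp m d) \<in> S) = (\<not> (src m d \<in> S))" if "d \<in> darts m" for d
      using S[OF that] by (auto simp: tgt_def)
  qed
qed

end

section \<open>Universal covers\<close>

definition walk_end :: "('d, 'z) rot_system_scheme \<Rightarrow> 'd set \<Rightarrow> 'd list \<Rightarrow> 'd set" where
  "walk_end m v p = (if p = [] then v else tgt m (last p))"

lemma walk_end_simps [simp]:
  "walk_end m v [] = v"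
  "walk_end m v (d # p) = walk_end m (tgt m d) p"
  "walk_end m v (p @ q) = walk_end m (walk_end m v p) q"
  by (auto simp: walk_end_def)

lemma walk_append [simp]: "walk m v (p @ q) \<longleftrightarrow> walk m v p \<and> walk m (walk_end m v p) q"
  by (induction p arbitrary: v) auto

lemma walk_darts: "walk m v p \<Longrightarrow> set p \<subseteq> darts m"
  by (induction p arbitrary: v) auto

lemma length_contour: "length (contour m d) = card (face m d)"
  by (simp add: contour_def)

context finite_map begin

lemma walk_trail:
  "d \<in> darts m \<Longrightarrow> walk m (src m d) (map (\<lambda>k. (face_perm m ^^ k) d) [0..<n]) \<and>
    walk_end m (src m d) (map (\<lambda>k. (face_perm m ^^ k) d) [0..<n]) = src m ((face_perm m ^^ n) d)"
  by (induction n) (auto simp: face_perm_funpow_closed src_face_perm)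

lemma walk_contour:
  assumes "d \<in> darts m"
  shows "walk m (src m d) (contour m d)" "walk_end m (src m d) (contour m d) = src m d"
  using walk_trail[OF assms, of "card (face m d)"] by (auto simp: contour_def face_perm_funpow_card)

lemma contour_eq_Cons: "\<exists>p. contour m d = d # p"
  unfolding contour_def using card_face_pos[of d]
  by (cases "card (face m d)") (auto simp: upt_rec[of 0])

lemma walk_contourD:
  assumes "walk m v (contour m d)"
  shows "d \<in> darts m" "src m d = v"
  using assms contour_eq_Cons[of d] by auto

lemma homotopic_walk:
  "homotopic m v p q \<Longrightarrow> walk m v p \<and> walk m v q \<and> walk_end m v p = walk_end m v q"
proof (induction rule: homotopic.induct)
  case (spur p d q)
  then show ?case by (auto simp: tgt_opp)
next
  case (disk p d q)
  then have "d \<in> darts m" "src m d = walk_end m v p" using walk_contourD by auto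
  then show ?case using disk walk_contour[of d] by auto
qed auto

lemma homotopic_append:
  "homotopic m v p q \<Longrightarrow> walk m v (p @ r) \<Longrightarrow> homotopic m v (p @ r) (q @ r)"
proof (induction rule: homotopic.induct)
  case (refl p)
  show ?case using refl.prems by (rule homotopic.refl)
next
  case (sym p q)
  then show ?case using homotopic_walk[OF sym.hyps] by (auto intro: homotopic.sym)
next
  case (trans p q s)
  then show ?case using homotopic_walk[OF trans.hyps(1)] by (auto intro: homotopic.trans)
next
  case (spur p d q)
  then show ?case using homotopic.spur[of m v p d "q @ r"] by simp
next
  case (disk p d q)
  then show ?case using homotopic.disk[of m v p d "q @ r"] by simp
qed

lemma homotopic_prepend:
  "homotopic m (walk_end m v r) p q \<Longrightarrow> walk m v r \<Longrightarrow> homotopic m v (r @ p) (r @ q)"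
proof (induction rule: homotopic.induct)
  case (refl p)
  then show ?case by (intro homotopic.refl) auto
next
  case (spur p d q)
  then show ?case using homotopic.spur[of m v "r @ p" d q] by simp
next
  case (disk p d q)
  then show ?case using homotopic.disk[of m v "r @ p" d q] by simp
qed (auto intro: homotopic.sym homotopic.trans)

lemma homotopic_cancel_Cons:
  assumes "homotopic m v (d # p) (d # q)"
  shows "homotopic m (tgt m d) p q"
proof -
  have w: "walk m v (d # p)" "walk m v (d # q)" using homotopic_walk[OF assms] by auto
  then have d: "d \<in> darts m" "src m d = v" by auto
  have "homotopic m (tgt m d) ([opp m d] @ d # p) ([opp m d] @ d # q)"
    by (rule homotopic_prepend) (use assms d in \<open>auto simp: tgt_opp opp_closed tgt_def opp_opp\<close>)
  moreover have "homotopic m (tgt m d) ([opp m d] @ d # r) r" if "walk m v (d # r)" for r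
    using homotopic.spur[of m "tgt m d" "[]" "opp m d" r] that d
    by (auto simp: tgt_opp opp_closed tgt_def opp_opp)
  ultimately show ?thesis using w homotopic.sym homotopic.trans by metis
qed

lemma homotopic_cancel:
  "homotopic m v (r @ p) (r @ q) \<Longrightarrow> homotopic m (walk_end m v r) p q"
  by (induction r arbitrary: v) (auto dest: homotopic_cancel_Cons)

lemma homotopic_parity:
  assumes "\<And>d. d \<in> darts m \<Longrightarrow> even (card (face m d))"
  shows "homotopic m v p q \<Longrightarrow> even (length p) \<longleftrightarrow> even (length q)"
proof (induction rule: homotopic.induct)
  case (disk p d q)
  then show ?case using assms walk_contourD(1) by (auto simp: length_contour)
qed auto

lemma exists_walk:
  assumes "v \<in> vertices m" "w \<in> vertices m"
  shows "\<exists>p. walk m v p \<and> walk_end m v p = w"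
proof -
  obtain d e where de: "d \<in> darts m" "v = src m d" "e \<in> darts m" "w = src m e"
    using assms by (auto simp: vertices_def)
  have "\<exists>p. walk m v p \<and> walk_end m v p = src m e"
  proof (rule connected_induct[OF de(1,3)])
    show "\<exists>p. walk m v p \<and> walk_end m v p = src m d" using de(2) by (intro exI[of _ "[]"]) auto
  next
    fix x assume x: "x \<in> darts m" "\<exists>p. walk m v p \<and> walk_end m v p = src m x"
    then obtain p where "walk m v p" "walk_end m v p = src m x" by auto
    then show "\<exists>p. walk m v p \<and> walk_end m v p = src m (opp m x)"
      using x(1) by (intro exI[of _ "p @ [x]"]) (auto simp: tgt_def)
  qed (simp add: src_rot)
  then show ?thesis using de by simp
qed

lemma hclass_eqI: "homotopic m v p q \<Longrightarrow> hclass m v p = hclass m v q"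
  unfolding hclass_def by (blast intro: homotopic.intros(2,3))

lemma hclass_eq_iff:
  assumes "walk m v p"
  shows "hclass m v p = hclass m v q \<longleftrightarrow> homotopic m v p q"
proof
  assume eq: "hclass m v p = hclass m v q"
  have "p \<in> hclass m v p" using assms by (simp add: hclass_def homotopic.refl)
  then have "homotopic m v q p" unfolding eq by (simp add: hclass_def)
  then show "homotopic m v p q" by (rule homotopic.sym)
qed (rule hclass_eqI)

lemma Union_hclass:
  assumes "walk m v p" "\<And>q. homotopic m v p q \<Longrightarrow> F q = F p"
  shows "(\<Union>q\<in>hclass m v p. F q) = F p"
proof -
  have "p \<in> hclass m v p" using assms(1) by (simp add: hclass_def homotopic.refl)
  moreover have "F q = F p" if "q \<in> hclass m v p" for q
    using that by (intro assms(2)) (simp add: hclass_def)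
  ultimately show ?thesis by blast
qed

abbreviation cover where "cover v \<equiv> universal_cover m v"

lemma cover_darts: "darts (cover v) = {(hclass m v p, d) | p d. walk m v (p @ [d])}"
  and cover_rot: "rot (cover v) (C, d) = (C, rot m d)"
  by (simp_all add: universal_cover_def)

lemma cover_opp:
  assumes "walk m v (p @ [d])"
  shows "opp (cover v) (hclass m v p, d) = (hclass m v (p @ [d]), opp m d)"
proof -
  have "(\<Union>q\<in>hclass m v p. hclass m v (q @ [d])) = hclass m v (p @ [d])"
  proof (rule Union_hclass)
    fix q assume "homotopic m v p q"
    then have "homotopic m v (p @ [d]) (q @ [d])" using assms by (rule homotopic_append)
    then show "hclass m v (q @ [d]) = hclass m v (p @ [d])" by (rule hclass_eqI[symmetric])
  qed (use assms in simp)
  then show ?thesis by (simp add: universal_cover_def)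
qed

lemma cover_dartE:
  assumes "D \<in> darts (cover v)"
  obtains p d where "D = (hclass m v p, d)" "walk m v p" "d \<in> darts m" "src m d = walk_end m v p"
  using assms by (auto simp: cover_darts)

lemma cover_src:
  assumes "d \<in> darts m"
  shows "src (cover v) (C, d) = Pair C ` src m d"
  unfolding src_def
  by (rule orbit_inverse[symmetric]) (use in_src[OF assms] in \<open>auto simp: src_def cover_rot\<close>)

lemma rotation_cover: "rotation (cover v)"
proof
  fix D assume "D \<in> darts (cover v)"
  then obtain p d where D: "D = (hclass m v p, d)" "walk m v p" "d \<in> darts m" "src m d = walk_end m v p"
    by (rule cover_dartE)
  have opp: "opp (cover v) D = (hclass m v (p @ [d]), opp m d)" using D by (simp add: cover_opp)
  show "rot (cover v) D \<in> darts (cover v)"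
    using D by (force simp: cover_rot cover_darts rot_closed src_rot)
  show "opp (cover v) D \<in> darts (cover v)"
    unfolding opp cover_darts using D
    by (auto simp: opp_closed tgt_def intro!: exI[of _ "p @ [d]"])
  show "opp (cover v) D \<noteq> D" using D opp opp_neq by auto
  have "homotopic m v (p @ [d, opp m d]) p"
    using homotopic.spur[of m v p d "[]"] D by (simp add: opp_closed tgt_def)
  then have "hclass m v (p @ [d, opp m d]) = hclass m v p"
    by (rule hclass_eqI)
  then show "opp (cover v) (opp (cover v) D) = D"
    unfolding opp using D by (subst cover_opp) (auto simp: opp_closed tgt_def opp_opp)
  show "D \<in> src (cover v) D" using D in_src by (auto simp: cover_src)
qed

text \<open>
  A vertex of the cover carries a homotopy class, and the parity of the length of its members is a
  proper 2-coloring.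
\<close>

lemma cover_even_cycle:
  assumes even: "\<And>d. d \<in> darts m \<Longrightarrow> even (card (face m d))"
    and c: "simple_cycle (cover v) c"
  shows "even (length c)"
proof -
  define h where "h D = (\<exists>p\<in>fst D. even (length p))" for D :: "'d list set \<times> 'd"
  have h: "h (hclass m v p, d) = even (length p)" if "walk m v p" for p d
  proof -
    have "h (hclass m v p, d) \<longleftrightarrow> (\<exists>q. homotopic m v p q \<and> even (length q))"
      by (auto simp: h_def hclass_def)
    then show ?thesis using homotopic_parity[OF even] homotopic.refl[OF that] by blast
  qed
  show ?thesis
  proof (rule rotation.even_simple_cycle[OF rotation_cover _ _ c])
    fix D assume "D \<in> darts (cover v)"
    then obtain p d where D: "D = (hclass m v p, d)" "walk m v p" "d \<in> darts m" "src m d = walk_end m v p"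
      by (rule cover_dartE)
    show "h (rot (cover v) D) = h D" using D by (simp add: cover_rot h)
    show "h (opp (cover v) D) = (\<not> h D)" using D by (simp add: cover_opp h)
  qed
qed

lemma cover_face_perm:
  assumes "walk m v (p @ [d])"
  shows "face_perm (cover v) (hclass m v p, d) = (hclass m v (p @ [d]), face_perm m d)"
  using assms by (simp add: face_perm_def cover_opp cover_rot)

lemma cover_face_perm_funpow:
  assumes "walk m v p" "d \<in> darts m" "src m d = walk_end m v p"
  shows "(face_perm (cover v) ^^ k) (hclass m v p, d) =
    (hclass m v (p @ map (\<lambda>k. (face_perm m ^^ k) d) [0..<k]), (face_perm m ^^ k) d)"
proof (induction k)
  case (Suc k)
  have "walk m v (p @ map (\<lambda>k. (face_perm m ^^ k) d) [0..<Suc k])"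
    using assms walk_trail[OF assms(2), of "Suc k"] by auto
  then show ?case using Suc by (simp add: cover_face_perm)
qed simp

lemma card_cover_face:
  assumes "D \<in> darts (cover v)" "finite (face (cover v) D)"
  shows "card (face m (snd D)) \<le> card (face (cover v) D)"
proof -
  obtain p d where D: "D = (hclass m v p, d)" "walk m v p" "d \<in> darts m" "src m d = walk_end m v p"
    using assms(1) by (rule cover_dartE)
  have "face m d \<subseteq> snd ` face (cover v) D"
  proof
    fix e assume "e \<in> face m d"
    then obtain k where "0 < k" "e = (face_perm m ^^ k) d" by (auto simp: face_def orbit_altdef)
    then have "(face_perm (cover v) ^^ k) D \<in> face (cover v) D" "e = snd ((face_perm (cover v) ^^ k) D)"
      using D by (auto simp: face_def orbit_altdef cover_face_perm_funpow)
    then show "e \<in> snd ` face (cover v) D" by blast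
  qed
  then show ?thesis using D assms(2) by (simp add: surj_card_le)
qed

lemma cover_face_perm_funpow_card:
  assumes "D \<in> darts (cover v)"
  shows "(face_perm (cover v) ^^ card (face m (snd D))) D = D"
proof -
  obtain p d where D: "D = (hclass m v p, d)" "walk m v p" "d \<in> darts m" "src m d = walk_end m v p"
    using assms by (rule cover_dartE)
  have "homotopic m v (p @ contour m d) p"
    using homotopic.disk[of m v p d "[]"] D walk_contour[of d] by simp
  then have "hclass m v (p @ contour m d) = hclass m v p"
    by (rule hclass_eqI)
  then show ?thesis
    using D by (simp add: cover_face_perm_funpow face_perm_funpow_card flip: contour_def)
qed

lemma cover_no_leaf_turn:
  assumes "\<forall>v\<in>vertices m. card v \<noteq> 1" "D \<in> darts (cover v)"
  shows "face_perm (cover v) D \<noteq> opp (cover v) D"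
proof -
  obtain p d where D: "D = (hclass m v p, d)" "walk m v p" "d \<in> darts m" "src m d = walk_end m v p"
    using assms(2) by (rule cover_dartE)
  then show ?thesis using no_leaf_turn[OF assms(1) D(3)] by (simp add: cover_face_perm cover_opp)
qed

lemma cover_dart_above:
  assumes "v \<in> vertices m" "d \<in> darts m"
  obtains C where "(C, d) \<in> darts (cover v)"
proof -
  obtain p where "walk m v p" "walk_end m v p = src m d"
    using exists_walk[OF assms(1), of "src m d"] assms(2) by (auto simp: vertices_def)
  then have "(hclass m v p, d) \<in> darts (cover v)"
    using assms(2) by (auto simp: cover_darts)
  then show ?thesis by (rule that)
qed

lemma base_vertex_in: "base_vertex m \<in> vertices m"
proof -
  have "vertices m \<noteq> {}" using is_map by (auto simp: is_map_def vertices_def)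
  then show ?thesis unfolding base_vertex_def by (meson ex_in_conv someI_ex)
qed

end

locale map_embedding = X: finite_map X + Y: finite_map Y
  for X :: "('d, 'y) rot_system_scheme" and Y :: "('e, 'z) rot_system_scheme" +
  fixes f :: "'d \<Rightarrow> 'e"
  assumes embedding: "rot_embedding f X Y"
begin

lemma inj: "inj_on f (darts X)" and image_darts: "f ` darts X \<subseteq> darts Y"
  using embedding by (auto simp: rot_embedding_def)

lemma f_dart: "d \<in> darts X \<Longrightarrow> f d \<in> darts Y"
  and f_rot: "d \<in> darts X \<Longrightarrow> f (rot X d) = rot Y (f d)"
  and f_opp: "d \<in> darts X \<Longrightarrow> f (opp X d) = opp Y (f d)"
  using embedding by (auto simp: rot_embedding_def)

lemma f_src: "d \<in> darts X \<Longrightarrow> src Y (f d) = f ` src X d"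
  and f_tgt: "d \<in> darts X \<Longrightarrow> tgt Y (f d) = f ` tgt X d"
  using X.embedding_src[OF embedding] X.embedding_tgt[OF embedding] by auto

lemma f_face_perm: "d \<in> darts X \<Longrightarrow> f (face_perm X d) = face_perm Y (f d)"
  by (simp add: face_perm_def X.opp_closed f_rot f_opp)

lemma f_face_perm_funpow: "d \<in> darts X \<Longrightarrow> f ((face_perm X ^^ k) d) = (face_perm Y ^^ k) (f d)"
  by (induction k) (simp_all add: f_face_perm X.face_perm_funpow_closed)

lemma f_face:
  assumes "d \<in> darts X"
  shows "face Y (f d) = f ` face X d"
  unfolding face_def
proof (rule orbit_inverse[symmetric])
  show "d \<in> orbit (face_perm X) d" using X.in_face by (simp add: face_def)
  show "face_perm Y (f x) = f (face_perm X x)" if "x \<in> orbit (face_perm X) d" for x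
    using that X.face_subset[OF assms] f_face_perm[of x] by (auto simp: face_def)
qed

lemma f_contour: "d \<in> darts X \<Longrightarrow> map f (contour X d) = contour Y (f d)"
  using card_image[OF inj_on_subset[OF inj X.face_subset]]
  by (simp add: contour_def f_face f_face_perm_funpow)

lemma walk_map: "walk X v p \<Longrightarrow> walk Y (f ` v) (map f p) \<and> walk_end Y (f ` v) (map f p) = f ` walk_end X v p"
  by (induction p arbitrary: v) (auto simp: f_dart f_src f_tgt)

lemma homotopic_map: "homotopic X v p q \<Longrightarrow> homotopic Y (f ` v) (map f p) (map f q)"
proof (induction rule: homotopic.induct)
  case (refl p)
  then show ?case using walk_map by (blast intro: homotopic.refl)
next
  case (spur p d q)
  then show ?case using walk_map[OF spur] homotopic.spur[of Y "f ` v" "map f p" "f d" "map f q"]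
    by (simp add: f_opp)
next
  case (disk p d q)
  then have "d \<in> darts X" by (auto dest: X.walk_contourD(1))
  then show ?case using walk_map[OF disk] homotopic.disk[of Y "f ` v" "map f p" "f d" "map f q"]
    by (simp add: f_contour)
qed (auto intro: homotopic.sym homotopic.trans)

end

locale map_iso = map_embedding +
  assumes surj: "f ` darts X = darts Y"
begin

lemma inverse: "map_iso Y X (the_inv_into (darts X) f)"
proof
  let ?g = "the_inv_into (darts X) f"
  have g: "?g (f d) = d" if "d \<in> darts X" for d using inj that by (rule the_inv_into_f_f)
  show "rot_embedding ?g Y X"
    unfolding rot_embedding_def surj[symmetric] using inj
    by (auto simp: g X.rot_closed X.opp_closed simp flip: f_rot f_opp intro!: inj_onI)
  show "?g ` darts Y = darts X" unfolding surj[symmetric] using inj by (rule the_inv_into_onto)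
qed

lemma homotopic_map_iff:
  assumes "walk X v p" "walk X v q" "v \<subseteq> darts X"
  shows "homotopic Y (f ` v) (map f p) (map f q) \<longleftrightarrow> homotopic X v p q"
proof
  let ?g = "the_inv_into (darts X) f"
  have g: "?g (f d) = d" if "d \<in> darts X" for d using inj that by (rule the_inv_into_f_f)
  have "map ?g (map f r) = r" if "walk X v r" for r
    using walk_darts[OF that] g by (simp add: map_idI subset_iff)
  moreover have "?g ` f ` v = v" using assms(3) g by (force simp: image_iff)
  ultimately show "homotopic X v p q" if "homotopic Y (f ` v) (map f p) (map f q)"
    using map_embedding.homotopic_map[OF map_iso.axioms(1)[OF inverse] that] assms by simp
qed (rule homotopic_map)

lemma cover_girth_le:
  assumes v: "v \<in> vertices X" and v': "v' \<in> vertices Y"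
  shows "girth (universal_cover Y v') \<le> girth (universal_cover X v)"
proof -
  have fv: "f ` v \<in> vertices Y" and sub: "v \<subseteq> darts X"
  proof -
    obtain d where d: "d \<in> darts X" "v = src X d" using v by (auto simp: vertices_def)
    then show "v \<subseteq> darts X" using X.src_subset by simp
    have "f ` v = src Y (f d)" using d f_src by simp
    then show "f ` v \<in> vertices Y" using d f_dart by (auto simp: vertices_def)
  qed
  obtain r where r: "walk Y v' r" "walk_end Y v' r = f ` v"
    using Y.exists_walk[OF v' fv] by auto
  define F where "F = (\<lambda>(C, d). (\<Union>p\<in>C. hclass Y v' (r @ map f p), f d))"
  have hom: "homotopic Y v' (r @ map f p) (r @ map f q) \<longleftrightarrow> homotopic X v p q"
    if "walk X v p" "walk X v q" for p q
    using homotopic_map_iff[OF that sub] Y.homotopic_prepend[of v' r "map f p" "map f q"]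
      Y.homotopic_cancel[of v' r "map f p" "map f q"] r by auto
  have walk: "walk Y v' (r @ map f p)" "walk_end Y v' (r @ map f p) = f ` walk_end X v p" if "walk X v p" for p
    using walk_map[OF that] r by auto
  have F: "F (hclass X v p, d) = (hclass Y v' (r @ map f p), f d)" if p: "walk X v p" for p d
  proof -
    have "(\<Union>q\<in>hclass X v p. hclass Y v' (r @ map f q)) = hclass Y v' (r @ map f p)"
    proof (rule X.Union_hclass[OF p])
      fix q assume q: "homotopic X v p q"
      then have "homotopic Y v' (r @ map f p) (r @ map f q)"
        using hom p X.homotopic_walk by blast
      then show "hclass Y v' (r @ map f q) = hclass Y v' (r @ map f p)"
        by (rule Y.hclass_eqI[symmetric])
    qed
    then show ?thesis by (simp add: F_def)
  qed
  have "rot_embedding F (universal_cover X v) (universal_cover Y v')"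
    unfolding rot_embedding_def
  proof (intro conjI ballI inj_onI subsetI)
    fix D E assume "D \<in> darts (universal_cover X v)" "E \<in> darts (universal_cover X v)" and eq: "F D = F E"
    then obtain p d q e where D: "D = (hclass X v p, d)" "walk X v p" "d \<in> darts X"
      and E: "E = (hclass X v q, e)" "walk X v q" "e \<in> darts X"
      by (metis X.cover_dartE)
    then show "D = E"
      using eq hom[OF D(2) E(2)] walk[OF D(2)] inj
      by (simp add: F Y.hclass_eq_iff X.hclass_eq_iff inj_on_def)
  next
    fix D' assume "D' \<in> F ` darts (universal_cover X v)"
    then obtain p d where D: "D' = F (hclass X v p, d)" "walk X v p" "d \<in> darts X" "src X d = walk_end X v p"
      by (auto elim!: X.cover_dartE)
    then have "walk Y v' ((r @ map f p) @ [f d])"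
      using walk[OF D(2)] by (simp add: f_dart f_src)
    then show "D' \<in> darts (universal_cover Y v')"
      unfolding Y.cover_darts using D F by blast
  next
    fix D assume "D \<in> darts (universal_cover X v)"
    then obtain p d where D: "D = (hclass X v p, d)" "walk X v p" "d \<in> darts X" "src X d = walk_end X v p"
      by (rule X.cover_dartE)
    have w: "walk Y v' ((r @ map f p) @ [f d])" "walk X v (p @ [d])"
      using walk[OF D(2)] D by (simp_all add: f_dart f_src)
    show "F (rot (universal_cover X v) D) = rot (universal_cover Y v') (F D)"
      using D by (simp add: F X.cover_rot Y.cover_rot f_rot)
    show "F (opp (universal_cover X v) D) = opp (universal_cover Y v') (F D)"
      unfolding D(1) F[OF D(2)] X.cover_opp[OF w(2)] Y.cover_opp[OF w(1)] F[OF w(2)]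
      using D(3) by (simp add: f_opp)
  qed
  then show ?thesis by (rule rotation.embedding_girth[OF X.rotation_cover])
qed

end

section \<open>Essential girth\<close>

lemma irreducible_iff_girth:
  assumes even: "\<And>c. simple_cycle X c \<Longrightarrow> even (length c)"
    and faces: "\<And>F. F \<in> faces X \<Longrightarrow> finite F \<Longrightarrow> 2 * b \<le> card F"
    and b: "1 \<le> b"
  shows "irreducible_map X (b - 1) \<longleftrightarrow> enat (2 * b) \<le> girth X"
proof
  assume irr: "irreducible_map X (b - 1)"
  have "2 * b \<le> length c" if c: "simple_cycle X c" for c
  proof -
    have "length c \<noteq> 2 * (b - 1)"
    proof
      assume len: "length c = 2 * (b - 1)"
      then obtain F where F: "F \<in> faces X" "card F = 2 * (b - 1)"
        using irr c unfolding irreducible_map_def by blast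
      moreover have "0 < length c" using c by (auto simp: simple_cycle_def)
      ultimately have "finite F" using len by (intro card_ge_0_finite) simp
      then show False using faces[OF F(1)] F(2) b by simp
    qed
    moreover have "2 * (b - 1) \<le> length c" using irr c by (simp add: irreducible_map_def)
    ultimately show ?thesis using even[OF c] b by presburger
  qed
  then show "enat (2 * b) \<le> girth X" by (simp add: girth_ge_iff)
next
  assume "enat (2 * b) \<le> girth X"
  then have "2 * b \<le> length c" if "simple_cycle X c" for c using that by (simp add: girth_ge_iff)
  then show "irreducible_map X (b - 1)" using b by (fastforce simp: irreducible_map_def)
qed

lemma girth_eq_even_iff:
  assumes "\<And>c. simple_cycle X c \<Longrightarrow> even (length c)"
  shows "girth X = enat (2 * b) \<longleftrightarrow> enat (2 * b) \<le> girth X \<and> \<not> enat (2 * (b + 1)) \<le> girth X"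
proof -
  have "Suc (2 * b) \<le> length c \<longleftrightarrow> 2 * (b + 1) \<le> length c" if "simple_cycle X c" for c
    using assms[OF that] by presburger
  then show ?thesis unfolding girth_eq_iff girth_ge_iff by blast
qed

lemma (in rotation) girth_le_face:
  assumes "\<And>d. d \<in> darts X \<Longrightarrow> face_perm X d \<noteq> opp X d"
    and d: "d \<in> darts X" "(face_perm X ^^ k) d = d" and "0 < k"
  shows "girth X \<le> enat k"
proof -
  obtain c where c: "simple_cycle X c" "length c \<le> k"
    using short_simple_cycle[of "\<lambda>i. (face_perm X ^^ i) d" k] assms
    by (auto simp: face_perm_funpow_closed src_face_perm)
  then show ?thesis unfolding girth_def by (intro INF_lower2[of c]) auto
qed

locale even_map = finite_map +
  assumes even_faces: "\<And>d. d \<in> darts m \<Longrightarrow> even (card (face m d))"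
    and no_leaves: "\<forall>v\<in>vertices m. card v \<noteq> 1"
begin

abbreviation lift where "lift \<equiv> universal_cover m (base_vertex m)"

lemma planar_even_cycle:
  assumes "has_genus m 0" "simple_cycle m c"
  shows "even (length c)"
proof -
  interpret even_planar_map m
    using assms(1) even_faces by unfold_locales
  show ?thesis using assms(2) by (rule even_planar_cycle)
qed

lemma essentially_irreducible_iff:
  assumes b: "1 \<le> b" and faces: "\<And>d. d \<in> darts m \<Longrightarrow> 2 * b \<le> card (face m d)"
  shows "essentially_irreducible m (b - 1) \<longleftrightarrow> enat (2 * b) \<le> essential_girth m"
proof (cases "has_genus m 0")
  case True
  have "irreducible_map m (b - 1) \<longleftrightarrow> enat (2 * b) \<le> girth m"
    by (rule irreducible_iff_girth[OF planar_even_cycle[OF True] _ b])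
      (auto simp: faces_def faces)
  then show ?thesis using True by (simp add: essentially_irreducible_def essential_girth_def)
next
  case False
  have "irreducible_map lift (b - 1) \<longleftrightarrow> enat (2 * b) \<le> girth lift"
  proof (rule irreducible_iff_girth[OF cover_even_cycle[OF even_faces] _ b])
    fix F assume "F \<in> faces lift" "finite F"
    then obtain D where D: "D \<in> darts lift" "F = face lift D" by (auto simp: faces_def)
    then have "snd D \<in> darts m" by (auto elim: cover_dartE)
    then show "2 * b \<le> card F"
      using faces card_cover_face[OF D(1)] D(2) \<open>finite F\<close> by (metis le_trans)
  qed
  then show ?thesis using False by (simp add: essentially_irreducible_def essential_girth_def)
qed

lemma essential_girth_eq_iff:
  "essential_girth m = enat (2 * b) \<longleftrightarrow>
    enat (2 * b) \<le> essential_girth m \<and> \<not> enat (2 * (b + 1)) \<le> essential_girth m"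
proof (cases "has_genus m 0")
  case True
  then show ?thesis
    using girth_eq_even_iff[of m b, OF planar_even_cycle[OF True]] by (simp add: essential_girth_def)
next
  case False
  then show ?thesis
    using girth_eq_even_iff[of lift b, OF cover_even_cycle[OF even_faces]]
    by (simp add: essential_girth_def)
qed

lemma essential_girth_le_face:
  assumes d: "d \<in> darts m"
  shows "essential_girth m \<le> enat (card (face m d))"
proof (cases "has_genus m 0")
  case True
  then show ?thesis
    using girth_le_face[OF no_leaf_turn[OF no_leaves] d face_perm_funpow_card card_face_pos]
    by (simp add: essential_girth_def)
next
  case False
  obtain C where C: "(C, d) \<in> darts lift" using cover_dart_above[OF base_vertex_in d] .
  have "girth lift \<le> enat (card (face m d))"
    using rotation.girth_le_face[OF rotation_cover cover_no_leaf_turn[OF no_leaves] C]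
      cover_face_perm_funpow_card[OF C] card_face_pos by simp
  then show ?thesis using False by (simp add: essential_girth_def)
qed

end

lemma (in map_iso) essential_girth_le:
  assumes "has_genus X 0 \<longleftrightarrow> has_genus Y 0"
  shows "essential_girth Y \<le> essential_girth X"
  using assms X.embedding_girth[OF embedding] cover_girth_le[OF X.base_vertex_in Y.base_vertex_in]
  by (simp add: essential_girth_def)

lemma (in map_iso) essential_girth_eq:
  assumes "has_genus X 0 \<longleftrightarrow> has_genus Y 0"
  shows "essential_girth Y = essential_girth X"
  using essential_girth_le map_iso.essential_girth_le[OF inverse] assms by (auto intro: antisym)

section \<open>Counting isomorphism classes\<close>

lemma is_iso_map_iso:
  assumes "is_iso f m m'" "is_map m" "is_map m'"
  shows "map_iso m m' f"
proof -
  interpret X: finite_map m by unfold_locales (rule assms(2))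
  interpret Y: finite_map m' by unfold_locales (rule assms(3))
  show ?thesis
    by unfold_locales (use assms(1) in \<open>auto simp: is_iso_def rot_embedding_def bij_betw_def\<close>)
qed

lemma is_iso_trans:
  assumes "is_iso f m1 m2" "is_iso g m2 m3"
  shows "is_iso (g \<circ> f) m1 m3"
proof -
  have "f d \<in> darts m2" if "d \<in> darts m1" for d
    using assms(1) that bij_betwE by (fastforce simp: is_iso_def)
  then show ?thesis
    using assms by (auto simp: is_iso_def intro: bij_betw_trans)
qed

lemma is_iso_sym:
  assumes f: "is_iso f m1 m2" and m1: "is_map m1"
  shows "is_iso (the_inv_into (darts m1) f) m2 m1"
proof -
  interpret finite_map m1 by unfold_locales (rule m1)
  have bij: "bij_betw f (darts m1) (darts m2)" using f by (simp add: is_iso_def)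
  let ?g = "the_inv_into (darts m1) f"
  have g: "?g (f d) = d" if "d \<in> darts m1" for d
    using bij that by (simp add: bij_betw_def the_inv_into_f_f)
  have "?g (rot m2 e) = rot m1 (?g e) \<and> ?g (opp m2 e) = opp m1 (?g e) \<and> label m1 (?g e) = label m2 e"
    if e: "e \<in> darts m2" for e
  proof -
    obtain d where d: "d \<in> darts m1" "e = f d" using bij e unfolding bij_betw_def by blast
    then have "rot m2 e = f (rot m1 d)" "opp m2 e = f (opp m1 d)" "label m2 e = label m1 d"
      using f by (auto simp: is_iso_def)
    then show ?thesis using d g rot_closed opp_closed by simp
  qed
  then show ?thesis using bij_betw_the_inv_into[OF bij] by (simp add: is_iso_def)
qed

lemma is_iso_id: "is_iso id m m"
  by (simp add: is_iso_def)

lemma quotient_iso_rel: "M // iso_rel M = (\<lambda>m. {m' \<in> M. \<exists>f. is_iso f m m'}) ` M"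
  unfolding quotient_def iso_rel_def by (auto simp: Image_def)

lemma weighted_count_split:
  assumes fin: "finite (M // iso_rel M)"
    and Q: "\<And>m m' f. m \<in> M \<Longrightarrow> m' \<in> M \<Longrightarrow> is_iso f m m' \<Longrightarrow> Q m \<longleftrightarrow> Q m'"
  shows "weighted_count M = weighted_count {m \<in> M. Q m} + weighted_count {m \<in> M. \<not> Q m}"
proof -
  define cls where "cls m = {m' \<in> M. \<exists>f. is_iso f m m'}" for m :: "nat labeled_map"
  have M: "M // iso_rel M = cls ` M" by (simp add: quotient_iso_rel cls_def)
  have "(\<lambda>m. {m' \<in> {m \<in> M. Q m}. \<exists>f. is_iso f m m'}) m = cls m" if "m \<in> {m \<in> M. Q m}" for m
    using that Q by (auto simp: cls_def)
  then have A: "{m \<in> M. Q m} // iso_rel {m \<in> M. Q m} = cls ` {m \<in> M. Q m}"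
    unfolding quotient_iso_rel by (rule image_cong[OF HOL.refl])
  have "(\<lambda>m. {m' \<in> {m \<in> M. \<not> Q m}. \<exists>f. is_iso f m m'}) m = cls m" if "m \<in> {m \<in> M. \<not> Q m}" for m
    using that Q by (auto simp: cls_def)
  then have B: "{m \<in> M. \<not> Q m} // iso_rel {m \<in> M. \<not> Q m} = cls ` {m \<in> M. \<not> Q m}"
    unfolding quotient_iso_rel by (rule image_cong[OF HOL.refl])
  have "cls m \<noteq> cls m'" if "m \<in> M" "Q m" "m' \<in> M" "\<not> Q m'" for m m'
  proof
    assume "cls m = cls m'"
    moreover have "m \<in> cls m" using that is_iso_id by (auto simp: cls_def)
    ultimately show False using that Q[of m' m] by (auto simp: cls_def)
  qed
  then have disj: "cls ` {m \<in> M. Q m} \<inter> cls ` {m \<in> M. \<not> Q m} = {}" by blast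
  have un: "cls ` M = cls ` {m \<in> M. Q m} \<union> cls ` {m \<in> M. \<not> Q m}" by blast
  have "finite (cls ` {m \<in> M. Q m})" "finite (cls ` {m \<in> M. \<not> Q m})"
    using fin unfolding M un by auto
  then show ?thesis
    unfolding weighted_count_def M A B un by (rule sum.union_disjoint[OF _ _ disj])
qed

lemma card_darts_le:
  assumes m: "m \<in> maps g n l"
  shows "card (darts m) \<le> (\<Sum>i\<in>{1..n}. 2 * l i)"
proof -
  interpret finite_map m using m by unfold_locales (simp add: maps_def)
  have lab: "label m ` darts m = {1..n}"
      "\<And>d e. d \<in> darts m \<Longrightarrow> e \<in> darts m \<Longrightarrow> label m d = label m e \<longleftrightarrow> face m d = face m e"
    and deg: "\<And>d. d \<in> darts m \<Longrightarrow> card (face m d) = 2 * l (label m d)"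
    using m by (auto simp: maps_def faces_labeled_def)
  have "darts m = (\<Union>i\<in>{1..n}. {d \<in> darts m. label m d = i})" using lab(1) by auto
  then have "card (darts m) \<le> (\<Sum>i\<in>{1..n}. card {d \<in> darts m. label m d = i})"
    using card_UN_le[of "{1..n}" "\<lambda>i. {d \<in> darts m. label m d = i}"] by simp
  also have "\<dots> \<le> (\<Sum>i\<in>{1..n}. 2 * l i)"
  proof (rule sum_mono)
    fix i assume "i \<in> {1..n}"
    then obtain d where d: "d \<in> darts m" "label m d = i" using lab(1) by (metis imageE)
    then have "{e \<in> darts m. label m e = i} \<subseteq> face m d"
      using lab(2) in_face by blast
    then show "card {e \<in> darts m. label m e = i} \<le> 2 * l i"
      using card_mono[OF finite_face] deg[OF d(1)] d(2) by metis
  qed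
  finally show ?thesis .
qed

lemma finite_iso_classes:
  assumes M: "M \<subseteq> maps g n l"
  shows "finite (M // iso_rel M)"
proof -
  define K where "K = (\<Sum>i\<in>{1..n}. 2 * l i)"
  define cls where "cls m = {m' \<in> M. \<exists>f. is_iso f m m'}" for m :: "nat labeled_map"
  define F where "F k B = {f :: nat \<Rightarrow> nat. \<forall>x. (x \<in> {0..<k} \<longrightarrow> f x \<in> B) \<and> (x \<notin> {0..<k} \<longrightarrow> f x = 0)}" for k B
  define R where "R = (\<Union>k\<in>{0..K}. (\<lambda>(r, p, t). \<lparr>darts = {0..<k}, rot = r, opp = p, label = t\<rparr>) `
      (F k {0..<k} \<times> F k {0..<k} \<times> F k {1..n}))"
  have "finite (F k B)" if "finite B" for k B
    unfolding F_def using that by (intro finite_set_of_finite_funs) auto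
  then have "finite R" unfolding R_def by auto
  have "cls m \<in> cls ` R" if m: "m \<in> M" for m
  proof -
    have "m \<in> maps g n l" using M m by auto
    then have map: "is_map m" and lab: "label m ` darts m = {1..n}"
      by (auto simp: maps_def faces_labeled_def)
    interpret finite_map m by unfold_locales (rule map)
    define k where "k = card (darts m)"
    obtain h where h: "bij_betw h (darts m) {0..<k}"
      unfolding k_def using ex_bij_betw_finite_nat[OF finite_darts] by blast
    let ?g = "the_inv_into (darts m) h"
    have g: "?g (h d) = d" if "d \<in> darts m" for d
      using h that by (simp add: bij_betw_def the_inv_into_f_f)
    have g_dart: "?g x \<in> darts m" if "x < k" for x
      using bij_betw_the_inv_into[OF h] that by (auto dest: bij_betwE)
    have h_less: "h d < k" if "d \<in> darts m" for d using h that by (auto dest: bij_betwE)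
    define r where "r x = (if x < k then h (rot m (?g x)) else 0)" for x
    define p where "p x = (if x < k then h (opp m (?g x)) else 0)" for x
    define t where "t x = (if x < k then label m (?g x) else 0)" for x
    define m' where "m' = \<lparr>darts = {0..<k}, rot = r, opp = p, label = t\<rparr>"
    have "r \<in> F k {0..<k}" "p \<in> F k {0..<k}"
      using g_dart h_less rot_closed opp_closed by (auto simp: F_def r_def p_def)
    moreover have "t \<in> F k {1..n}" using g_dart lab by (force simp: F_def t_def)
    moreover have "k \<le> K" using card_darts_le[OF \<open>m \<in> maps g n l\<close>] by (simp add: k_def K_def)
    ultimately have "m' \<in> R" unfolding R_def m'_def by force
    have iso: "is_iso h m m'"
      using h g h_less by (simp add: is_iso_def m'_def r_def p_def t_def)
    have "cls m = cls m'"
      unfolding cls_def using is_iso_trans[OF iso] is_iso_trans[OF is_iso_sym[OF iso map]] by blast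
    then show ?thesis using \<open>m' \<in> R\<close> by blast
  qed
  then have "M // iso_rel M \<subseteq> cls ` R"
    unfolding quotient_iso_rel cls_def[symmetric] by blast
  then show ?thesis using \<open>finite R\<close> by (meson finite_imageI finite_subset)
qed

lemma maps_even_map:
  assumes "m \<in> maps g n l"
  shows "even_map m"
  by unfold_locales (use assms in \<open>auto simp: maps_def\<close>)

lemma maps_face_degree:
  assumes "m \<in> maps g n l" "\<forall>i\<in>{1..n}. k \<le> l i" "d \<in> darts m"
  shows "2 * k \<le> card (face m d)"
proof -
  have "label m d \<in> {1..n}" using assms by (auto simp: maps_def faces_labeled_def)
  then show ?thesis using assms by (simp add: maps_def)
qed

lemma G_hat_ge_eq_M_hat:
  assumes "1 \<le> b" "\<forall>i\<in>{1..n}. b \<le> l i"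
  shows "G_hat_ge b g n l = M_hat (b - 1) g n l"
  unfolding G_hat_ge_def M_hat_def
  using even_map.essentially_irreducible_iff[OF maps_even_map assms(1)] maps_face_degree[OF _ assms(2)]
  by blast

lemma G_hat_eq: "G_hat b g n l = {m \<in> G_hat_ge b g n l. \<not> enat (2 * (b + 1)) \<le> essential_girth m}"
  unfolding G_hat_def G_hat_ge_def
  using even_map.essential_girth_eq_iff[OF maps_even_map] by blast

lemma G_hat_ge_empty:
  assumes "i \<in> {1..n}" "l i < b"
  shows "G_hat_ge b g n l = {}"
proof (rule ccontr)
  assume "G_hat_ge b g n l \<noteq> {}"
  then obtain m where m: "m \<in> maps g n l" "enat (2 * b) \<le> essential_girth m"
    by (auto simp: G_hat_ge_def)
  then have "i \<in> label m ` darts m" using assms(1) by (simp add: maps_def faces_labeled_def)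
  then obtain d where d: "d \<in> darts m" "label m d = i" by blast
  have "essential_girth m \<le> enat (2 * l i)"
    using even_map.essential_girth_le_face[OF maps_even_map[OF m(1)] d(1)] d m(1) by (simp add: maps_def)
  then have "enat (2 * b) \<le> enat (2 * l i)" using m(2) by (rule order_trans[rotated])
  then show False using assms(2) by simp
qed

lemma weighted_count_G_hat:
  "weighted_count (G_hat b g n l) =
    weighted_count (G_hat_ge b g n l) - weighted_count (G_hat_ge (b + 1) g n l)"
proof -
  let ?M = "G_hat_ge b g n l" and ?Q = "\<lambda>m. enat (2 * (b + 1)) \<le> essential_girth m"
  have sub: "?M \<subseteq> maps g n l" by (auto simp: G_hat_ge_def)
  have "weighted_count ?M = weighted_count {m \<in> ?M. ?Q m} + weighted_count {m \<in> ?M. \<not> ?Q m}"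
  proof (rule weighted_count_split[OF finite_iso_classes[OF sub]])
    fix m m' f assume m: "m \<in> ?M" "m' \<in> ?M" and f: "is_iso f m m'"
    then have maps: "m \<in> maps g n l" "m' \<in> maps g n l" using sub by auto
    then interpret map_iso m m' f using f by (intro is_iso_map_iso) (auto simp: maps_def)
    have "has_genus m 0 \<longleftrightarrow> has_genus m' 0" using maps by (simp add: maps_def has_genus_def)
    then show "?Q m \<longleftrightarrow> ?Q m'" using essential_girth_eq by simp
  qed
  moreover have "{m \<in> ?M. ?Q m} = G_hat_ge (b + 1) g n l"
  proof -
    have "enat (2 * b) \<le> enat (2 * (b + 1))" by simp
    then show ?thesis unfolding G_hat_ge_def using order_trans by blast
  qed
  ultimately show ?thesis by (simp add: G_hat_eq)
qed

section \<open>Polynomiality\<close>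

lemma mpoly_eval_superset:
  assumes "finite S" "Poly_Mapping.keys P \<subseteq> S"
  shows "mpoly_eval P x = (\<Sum>e\<in>S. Poly_Mapping.lookup P e *
    (\<Prod>i\<in>Poly_Mapping.keys e. x i ^ Poly_Mapping.lookup e i))"
  unfolding mpoly_eval_def
  by (rule sum.mono_neutral_left) (use assms in \<open>auto simp: in_keys_iff\<close>)

definition polynomial_fun :: "nat \<Rightarrow> ((nat \<Rightarrow> real) \<Rightarrow> real) \<Rightarrow> bool" where
  "polynomial_fun n F \<longleftrightarrow> (\<exists>P. mpoly_vars P \<subseteq> {0..n} \<and> (\<forall>x. mpoly_eval P x = F x))"

lemma polynomial_fun_monomial:
  assumes "I \<subseteq> {0..n}"
  shows "polynomial_fun n (\<lambda>x. c * (\<Prod>i\<in>I. x i ^ k i))"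
proof -
  have fin: "finite I" using assms finite_subset by blast
  define e where "e = Abs_poly_mapping (\<lambda>i. if i \<in> I then k i else 0)"
  have lookup: "Poly_Mapping.lookup e i = (if i \<in> I then k i else 0)" for i
    unfolding e_def using fin by (subst lookup_Abs_poly_mapping) (auto elim: rev_finite_subset)
  have keys: "Poly_Mapping.keys e \<subseteq> I" by (auto simp: in_keys_iff lookup split: if_splits)
  let ?P = "Poly_Mapping.single e c"
  have "mpoly_vars ?P \<subseteq> {0..n}" using keys assms by (auto simp: mpoly_vars_def split: if_splits)
  moreover have "mpoly_eval ?P x = c * (\<Prod>i\<in>I. x i ^ k i)" for x
  proof -
    have "(\<Prod>i\<in>Poly_Mapping.keys e. x i ^ Poly_Mapping.lookup e i) = (\<Prod>i\<in>I. x i ^ k i)"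
      by (rule prod.mono_neutral_cong_left) (use fin keys in \<open>auto simp: in_keys_iff lookup split: if_splits\<close>)
    then show ?thesis by (simp add: mpoly_eval_superset[of "{e}"])
  qed
  ultimately show ?thesis unfolding polynomial_fun_def by blast
qed

lemma polynomial_fun_add:
  assumes "polynomial_fun n F" "polynomial_fun n G"
  shows "polynomial_fun n (\<lambda>x. F x + G x)"
proof -
  obtain P Q where P: "mpoly_vars P \<subseteq> {0..n}" "\<And>x. mpoly_eval P x = F x"
    and Q: "mpoly_vars Q \<subseteq> {0..n}" "\<And>x. mpoly_eval Q x = G x"
    using assms unfolding polynomial_fun_def by blast
  let ?S = "Poly_Mapping.keys P \<union> Poly_Mapping.keys Q"
  have sub: "Poly_Mapping.keys (P + Q) \<subseteq> ?S" by (rule Poly_Mapping.keys_add)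
  have "mpoly_vars (P + Q) \<subseteq> {0..n}" using sub P(1) Q(1) by (fastforce simp: mpoly_vars_def)
  moreover have "mpoly_eval (P + Q) x = F x + G x" for x
    unfolding P(2)[symmetric] Q(2)[symmetric]
    using sub by (simp add: mpoly_eval_superset[of ?S] lookup_add distrib_right sum.distrib)
  ultimately show ?thesis unfolding polynomial_fun_def by blast
qed

lemma polynomial_fun_sum:
  assumes "finite A" "\<And>a. a \<in> A \<Longrightarrow> polynomial_fun n (F a)"
  shows "polynomial_fun n (\<lambda>x. \<Sum>a\<in>A. F a x)"
  using assms
proof (induction A)
  case empty
  show ?case using polynomial_fun_monomial[of "{}" n 0] by simp
next
  case (insert a A)
  then show ?case by (simp add: polynomial_fun_add)
qed

lemma polynomial_fun_shift_square:
  assumes "mpoly_vars N \<subseteq> {0..n}"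
  shows "polynomial_fun n (\<lambda>x. s * mpoly_eval N (point (x 0 - a) (\<lambda>i. (x i)\<^sup>2)))"
proof -
  define k where "k = (\<lambda>e :: nat \<Rightarrow>\<^sub>0 nat. Poly_Mapping.lookup e 0)"
  define T where "T e j x = s * Poly_Mapping.lookup N e * of_nat (k e choose j) * (- a) ^ (k e - j) *
      (\<Prod>i\<in>insert 0 (Poly_Mapping.keys e - {0}). x i ^ (if i = 0 then j else 2 * Poly_Mapping.lookup e i))"
    for e j and x :: "nat \<Rightarrow> real"
  have "polynomial_fun n (T e j)" if "e \<in> Poly_Mapping.keys N" for e j
    unfolding T_def using assms that
    by (intro polynomial_fun_monomial) (auto simp: mpoly_vars_def)
  then have "polynomial_fun n (\<lambda>x. \<Sum>e\<in>Poly_Mapping.keys N. \<Sum>j\<le>k e. T e j x)"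
    by (intro polynomial_fun_sum) auto
  moreover have "(\<Sum>e\<in>Poly_Mapping.keys N. \<Sum>j\<le>k e. T e j x) =
      s * mpoly_eval N (point (x 0 - a) (\<lambda>i. (x i)\<^sup>2))" for x
  proof -
    let ?y = "point (x 0 - a) (\<lambda>i. (x i)\<^sup>2)"
    have "(\<Sum>j\<le>k e. T e j x) =
        s * (Poly_Mapping.lookup N e * (\<Prod>i\<in>Poly_Mapping.keys e. ?y i ^ Poly_Mapping.lookup e i))"
      for e
    proof -
      let ?R = "\<Prod>i\<in>Poly_Mapping.keys e - {0}. x i ^ (2 * Poly_Mapping.lookup e i)"
      have T: "T e j x = s * Poly_Mapping.lookup N e * ?R * (of_nat (k e choose j) * x 0 ^ j * (- a) ^ (k e - j))"
        for j
      proof -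
        have "(\<Prod>i\<in>insert 0 (Poly_Mapping.keys e - {0}). x i ^ (if i = 0 then j else 2 * Poly_Mapping.lookup e i))
            = x 0 ^ j * ?R"
          by (subst prod.insert) (auto intro!: prod.cong)
        then show ?thesis by (simp add: T_def)
      qed
      have "(\<Prod>i\<in>Poly_Mapping.keys e. ?y i ^ Poly_Mapping.lookup e i) =
          (\<Prod>i\<in>insert 0 (Poly_Mapping.keys e - {0}). ?y i ^ Poly_Mapping.lookup e i)"
        by (rule prod.mono_neutral_left) (auto simp: in_keys_iff)
      also have "\<dots> = (x 0 - a) ^ k e * ?R"
        by (subst prod.insert) (auto simp: point_def k_def power_mult intro!: prod.cong)
      also have "(x 0 - a) ^ k e = (\<Sum>j\<le>k e. of_nat (k e choose j) * x 0 ^ j * (- a) ^ (k e - j))"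
        using binomial_ring[of "x 0" "- a" "k e"] by simp
      finally have prod: "(\<Prod>i\<in>Poly_Mapping.keys e. ?y i ^ Poly_Mapping.lookup e i) =
          (\<Sum>j\<le>k e. of_nat (k e choose j) * x 0 ^ j * (- a) ^ (k e - j)) * ?R" .
      have "(\<Sum>j\<le>k e. T e j x) = s * Poly_Mapping.lookup N e * ?R *
          (\<Sum>j\<le>k e. of_nat (k e choose j) * x 0 ^ j * (- a) ^ (k e - j))"
        by (simp only: T sum_distrib_left)
      then show ?thesis unfolding prod by (simp only: mult_ac)
    qed
    then show ?thesis by (simp add: mpoly_eval_def sum_distrib_left)
  qed
  ultimately show ?thesis by simp
qed

lemma N_value_point:
  "mpoly_eval N (point (point b l 0 - a) (\<lambda>i. (point b l i)\<^sup>2)) = mpoly_eval N (point (b - a) (\<lambda>i. (l i)\<^sup>2))"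
proof -
  have "point (point b l 0 - a) (\<lambda>i. (point b l i)\<^sup>2) = point (b - a) (\<lambda>i. (l i)\<^sup>2)"
    by (auto simp: point_def)
  then show ?thesis by simp
qed

theorem mainTheorem3:
  fixes g n :: nat and N_hat :: mpoly
  assumes "n \<ge> 1" and "g = 0 \<Longrightarrow> n \<ge> 3" and "is_N_hat g n N_hat"
  shows
    "(\<forall>b l. b \<ge> 1 \<and> (\<forall>i\<in>{1..n}. l i \<ge> b) \<longrightarrow>
        weighted_count (G_hat_ge b g n l) = N_value N_hat (real b - 1) l \<and>
        weighted_count (G_hat b g n l) =
          N_value N_hat (real b - 1) l
          - (if \<forall>i\<in>{1..n}. l i > b then 1 else 0) * N_value N_hat (real b) l)
     \<and> (\<exists>P. mpoly_vars P \<subseteq> {0..n} \<and>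
          (\<forall>b l. b \<ge> 1 \<and> (\<forall>i\<in>{1..n}. l i \<ge> b) \<longrightarrow>
             weighted_count (G_hat_ge b g n l) = mpoly_eval P (point (real b) (\<lambda>i. real (l i)))))
     \<and> (\<exists>Q. mpoly_vars Q \<subseteq> {0..n} \<and>
          (\<forall>b l. b \<ge> 1 \<and> (\<forall>i\<in>{1..n}. l i > b) \<longrightarrow>
             weighted_count (G_hat b g n l) = mpoly_eval Q (point (real b) (\<lambda>i. real (l i)))))"
proof -
  have vars: "mpoly_vars N_hat \<subseteq> {0..n}" using assms(3) by (simp add: is_N_hat_def)
  have M_hat: "weighted_count (M_hat b g n l) = N_value N_hat (real b) l"
    if "\<forall>i\<in>{1..n}. b + 1 \<le> l i" for b l
  proof -
    have "1 \<in> {1..n}" using assms(1) by simp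
    then have "\<not> (\<forall>i\<in>{1..n}. l i = b)" using that by (metis not_less_eq_eq order_refl Suc_eq_plus1)
    moreover have "\<forall>i\<in>{1..n}. max b 1 \<le> l i" using that by fastforce
    ultimately show ?thesis using assms(3) by (simp add: is_N_hat_def)
  qed
  have ge: "weighted_count (G_hat_ge b g n l) = N_value N_hat (real b - 1) l"
    if "1 \<le> b" "\<forall>i\<in>{1..n}. b \<le> l i" for b l
    using that M_hat[of "b - 1" l] by (simp add: G_hat_ge_eq_M_hat of_nat_diff)
  have eq: "weighted_count (G_hat b g n l) = N_value N_hat (real b - 1) l
      - (if \<forall>i\<in>{1..n}. l i > b then 1 else 0) * N_value N_hat (real b) l"
    if b: "1 \<le> b" "\<forall>i\<in>{1..n}. b \<le> l i" for b l
  proof (cases "\<forall>i\<in>{1..n}. l i > b")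
    case True
    then have "weighted_count (G_hat_ge (b + 1) g n l) = N_value N_hat (real b) l"
      using ge[of "b + 1" l] by (simp add: Suc_le_eq)
    then show ?thesis using True ge[OF b] by (simp add: weighted_count_G_hat)
  next
    case False
    then obtain i where "i \<in> {1..n}" "l i < b + 1" by auto
    then have "weighted_count (G_hat_ge (b + 1) g n l) = 0"
      using G_hat_ge_empty[of i n l "b + 1" g] by (simp add: weighted_count_def quotient_def)
    then show ?thesis using False ge[OF b] by (auto simp: weighted_count_G_hat)
  qed
  have P: "polynomial_fun n (\<lambda>x. 1 * mpoly_eval N_hat (point (x 0 - 1) (\<lambda>i. (x i)\<^sup>2)))"
    using vars by (rule polynomial_fun_shift_square)
  have Q: "polynomial_fun n (\<lambda>x. 1 * mpoly_eval N_hat (point (x 0 - 1) (\<lambda>i. (x i)\<^sup>2))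
      + (- 1) * mpoly_eval N_hat (point (x 0 - 0) (\<lambda>i. (x i)\<^sup>2)))"
    using vars by (intro polynomial_fun_add polynomial_fun_shift_square)
  show ?thesis
  proof (intro conjI)
    obtain P where "mpoly_vars P \<subseteq> {0..n}"
      "\<And>x. mpoly_eval P x = 1 * mpoly_eval N_hat (point (x 0 - 1) (\<lambda>i. (x i)\<^sup>2))"
      using P unfolding polynomial_fun_def by blast
    then show "\<exists>P. mpoly_vars P \<subseteq> {0..n} \<and>
        (\<forall>b l. b \<ge> 1 \<and> (\<forall>i\<in>{1..n}. l i \<ge> b) \<longrightarrow>
           weighted_count (G_hat_ge b g n l) = mpoly_eval P (point (real b) (\<lambda>i. real (l i))))"
      by (intro exI[of _ P]) (simp add: ge N_value_def N_value_point)
    obtain Q where Q: "mpoly_vars Q \<subseteq> {0..n}"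
      "\<And>x. mpoly_eval Q x = 1 * mpoly_eval N_hat (point (x 0 - 1) (\<lambda>i. (x i)\<^sup>2))
        + (- 1) * mpoly_eval N_hat (point (x 0 - 0) (\<lambda>i. (x i)\<^sup>2))"
      using Q unfolding polynomial_fun_def by blast
    have "weighted_count (G_hat b g n l) = mpoly_eval Q (point (real b) (\<lambda>i. real (l i)))"
      if "1 \<le> b" "\<forall>i\<in>{1..n}. b < l i" for b l
    proof -
      have "\<forall>i\<in>{1..n}. b \<le> l i" using that by auto
      then show ?thesis
        unfolding Q(2) N_value_point using that by (simp add: eq N_value_def)
    qed
    then show "\<exists>Q. mpoly_vars Q \<subseteq> {0..n} \<and>
        (\<forall>b l. b \<ge> 1 \<and> (\<forall>i\<in>{1..n}. l i > b) \<longrightarrow>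
           weighted_count (G_hat b g n l) = mpoly_eval Q (point (real b) (\<lambda>i. real (l i))))"
      using Q(1) by blast
  qed (use ge eq in blast)
qed

end
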